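(* Let $\xi$ be a simple point process in $\mathbb{R}^d$ and let $A,B\subset\mathbb{R}^d$ be compact sets. Let $k\in\mathbb{N}^*$, let $D\subset\mathbb{R}^d$ be compact, let $h:(\mathbb{R}^d)^k\times\mathbf{N}\to\{0,1\}$ be measurable and translation-invariant, let $z:(\mathbb{R}^d)^k\to\mathbb{R}^d$ be measurable and translation-covariant, and let $$\zeta:=\sum_{\mathbf{x}\in\xi_{\neq}^k}h\big(\mathbf{x},\xi_{D_{z(\mathbf{x})}}\big)\,\delta_{z(\mathbf{x})}.$$ If $\xi$ and $\zeta$ are stationary (and $0<\mathbb{E}[\zeta](B)<\infty$, so that the quotient below is meaningful), then for any $p>0$, $q>0$ with $1/p+1/q\le1$, $$d_{\mathsf{TV}}\big(\xi_A,(\xi^{o,\zeta})_A\big)\le 4\,\frac{(\mathbb{E}[\zeta(B)^p])^{\frac1p}}{\mathbb{E}[\zeta](B)}\,\big(\beta^{\xi}_{B+D,B+A}\big)^{1-\frac1p-\frac1q},$$ where $o$ denotes the origin.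
   Context: $\mathbf{N}$ is the space of $\sigma$-finite (locally finite) counting measures on $\mathbb{R}^d$ with the $\sigma$-algebra $\mathcal{N}$ generated by the maps $\omega\mapsto\omega(B)$, $B$ Borel. A point process is a random element of $\mathbf{N}$; it is simple if $\xi(\{x\})\in\{0,1\}$ for all $x$, and is then identified with its support. $\xi_{\neq}^k$ is the set of $k$-tuples of pairwise distinct points of $\xi$. For $C\subset\mathbb{R}^d$, $\xi_C=\xi\cap C$ is the restriction of $\xi$ to $C$, and $C_z:=C+z$ for $z\in\mathbb{R}^d$; $B+D$ and $B+A$ are Minkowski sums. It is assumed that the mapping $\mathbb{R}^d\times\mathbf{N}\to\mathbb{R}^d\times\mathbf{N}$, $(z,\omega)\mapsto(z,\omega_{A_z})$, is product measurable. Translation-covariance of $z$ means $z(x_1+y,\dots,x_k+y)=z(x_1,\dots,x_k)+y$ for all $x_1,\dots,x_k,y\in\mathbb{R}^d$. $\mathbb{E}[\zeta]$ denotes the intensity measure $\mathbb{E}[\zeta](A)=\mathbb{E}[\zeta(A)]$. A Palm version of $\xi$ with respect to $\zeta$ is a family $\xi^{x,\zeta}$, $x\in\mathbb{R}^d$, of point processes such that for every measurable $f:\mathbb{R}^d\times\mathbf{N}\to[0,\infty)$, $\mathbb{E}\big[\int f(x,\xi)\,\zeta(\mathrm{d}x)\big]=\int\mathbb{E}[f(x,\xi^{x,\zeta})]\,\mathbb{E}[\zeta](\mathrm{d}x)$. In the stationary case, $\xi^{o,\zeta}$ is the (stationary) Palm version at the origin, i.e. $\xi^{x,\zeta}$ can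 be taken as the translate of $\xi^{o,\zeta}$ by $x$. Total variation distance: $d_{\mathsf{TV}}(\xi_1,\xi_2)=\sup_{\mathbf{A}\in\mathcal{N}}|\mathbb{P}(\xi_1\in\mathbf{A})-\mathbb{P}(\xi_2\in\mathbf{A})|$. $\beta$-mixing coefficient: for Borel sets $A,B$, with $\mathcal{N}_C$ the $\sigma$-field induced by $\mathcal{N}$ on $C$, $$\beta^{\xi}_{A,B}:=\frac12\int_{\mu_1\in\mathcal{N}_A}\int_{\mu_2\in\mathcal{N}_B}\big|\mathbb{P}(\xi_A\in\mathrm{d}\mu_1,\xi_B\in\mathrm{d}\mu_2)-\mathbb{P}(\xi_A\in\mathrm{d}\mu_1)\mathbb{P}(\xi_B\in\mathrm{d}\mu_2)\big|,$$ i.e. half the total mass of the total variation measure of the difference between the joint law of $(\xi_A,\xi_B)$ and the product of its marginals.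
   Formalization: Added hypothesis: almost surely every k-tuple x of distinct points of ξ with h(x, ξ_{D_{z(x)}})=1 has all its points in D_{z(x)}. Without it the claim fails, e.g. ξ Poisson, k=1, h=1, D={0}, z(x)=x+v, with A, B small balls at −v and o. *)

theory Defs
  imports "HOL-Probability.Probability" "HOL-Library.Set_Algebras"
begin

text \<open>
  The ambient space \<open>\<real>\<^sup>d\<close> is an arbitrary type \<open>'a::euclidean_space\<close>; a \<open>k\<close>-tuple of points is an
  element of \<open>'a ^ 'k\<close> with \<open>k = CARD('k) \<ge> 1\<close>, whose Borel sigma-algebra is the product one.
\<close>

definition counting_measures :: "'a::euclidean_space measure set" where
  "counting_measures = {\<mu>. sets \<mu> = sets borel
     \<and> (\<forall>C\<in>sets borel. emeasure \<mu> C \<in> range ennreal_of_enat)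
     \<and> (\<forall>K. compact K \<longrightarrow> emeasure \<mu> K < \<top>)}"

text \<open>The smallest sigma-algebra making all evaluations \<open>\<mu> \<mapsto> \<mu>(C)\<close> measurable, set up in the same
  way as \<^const>\<open>subprob_algebra\<close>.\<close>

definition config_algebra :: "'a::euclidean_space measure measure" where
  "config_algebra = (SUP C \<in> sets borel. vimage_algebra counting_measures (\<lambda>\<mu>. emeasure \<mu> C) borel)"

lemma space_config_algebra: "space config_algebra = counting_measures"
  by (auto simp: config_algebra_def space_Sup_eq_UN)

lemma measurable_emeasure_config_algebra:
  assumes "C \<in> sets borel"
  shows "(\<lambda>\<mu>. emeasure \<mu> C) \<in> borel_measurable config_algebra"
  unfolding config_algebra_def using assms
  by (auto intro!: measurable_Sup1 measurable_vimage_algebra1)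

abbreviation point_process :: "'w measure \<Rightarrow> ('w \<Rightarrow> 'a::euclidean_space measure) \<Rightarrow> bool" where
  "point_process M \<xi> \<equiv> \<xi> \<in> M \<rightarrow>\<^sub>M config_algebra"

definition simple_process :: "'w measure \<Rightarrow> ('w \<Rightarrow> 'a::euclidean_space measure) \<Rightarrow> bool" where
  "simple_process M \<xi> \<longleftrightarrow> point_process M \<xi> \<and> (AE \<omega> in M. \<forall>x. emeasure (\<xi> \<omega>) {x} \<in> {0, 1})"

definition points :: "'a measure \<Rightarrow> 'a set" where
  "points \<mu> = {x. emeasure \<mu> {x} \<noteq> 0}"

definition distinct_tuples :: "'a measure \<Rightarrow> ('a ^ 'k) set" where
  "distinct_tuples \<mu> = {x. (\<forall>i. x $ i \<in> points \<mu>) \<and> inj (\<lambda>i. x $ i)}"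

text \<open>The restriction \<open>\<mu>(C \<inter> _)\<close>, kept as a measure on the whole space.\<close>

definition restr :: "'a::euclidean_space set \<Rightarrow> 'a measure \<Rightarrow> 'a measure" where
  "restr C \<mu> = density \<mu> (indicator C)"

definition shift :: "'a::euclidean_space \<Rightarrow> 'a measure \<Rightarrow> 'a measure" where
  "shift y \<mu> = distr \<mu> borel (\<lambda>x. x + y)"

definition shift_set :: "'a::euclidean_space \<Rightarrow> 'a set \<Rightarrow> 'a set" where
  "shift_set y C = (\<lambda>x. x + y) ` C"

definition shift_tuple :: "'a::euclidean_space \<Rightarrow> 'a ^ 'k \<Rightarrow> 'a ^ 'k" where
  "shift_tuple y x = (\<chi> i. x $ i + y)"

definition stationary_process :: "'w measure \<Rightarrow> ('w \<Rightarrow> 'a::euclidean_space measure) \<Rightarrow> bool" where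
  "stationary_process M \<xi> \<longleftrightarrow> point_process M \<xi> \<and>
     (\<forall>y. distr M config_algebra (\<lambda>\<omega>. shift y (\<xi> \<omega>)) = distr M config_algebra \<xi>)"

text \<open>The measure \<open>\<Sum> h(x, \<mu>\<^bsub>D + z(x)\<^esub>) \<delta>\<^bsub>z(x)\<^esub>\<close>, the sum being over all \<open>x \<in> distinct_tuples \<mu>\<close>: the image
  under \<open>z\<close> of the counting measure on the tuples, weighted by \<open>h\<close>; see \<open>emeasure_tuple_process\<close>.\<close>

definition tuple_process ::
  "('a ^ 'k \<Rightarrow> 'a measure \<Rightarrow> real) \<Rightarrow> ('a ^ 'k \<Rightarrow> 'a) \<Rightarrow> 'a set \<Rightarrow> 'a::euclidean_space measure \<Rightarrow> 'a measure"
where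
  "tuple_process h z D \<mu> =
     distr (density (count_space (distinct_tuples \<mu>)) (\<lambda>x. ennreal (h x (restr (shift_set (z x) D) \<mu>))))
       borel z"

lemma emeasure_tuple_process:
  assumes "C \<in> sets borel"
  shows "emeasure (tuple_process h z D \<mu>) C =
    (\<integral>\<^sup>+ x. ennreal (h x (restr (shift_set (z x) D) \<mu>)) * indicator C (z x) \<partial>count_space (distinct_tuples \<mu>))"
proof -
  have *: "z \<in> density (count_space (distinct_tuples \<mu>))
      (\<lambda>x. ennreal (h x (restr (shift_set (z x) D) \<mu>))) \<rightarrow>\<^sub>M borel"
    by simp
  have "emeasure (tuple_process h z D \<mu>) C =
    (\<integral>\<^sup>+ x. ennreal (h x (restr (shift_set (z x) D) \<mu>)) * indicator (z -` C \<inter> distinct_tuples \<mu>) x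
      \<partial>count_space (distinct_tuples \<mu>))"
    unfolding tuple_process_def using assms
    by (subst emeasure_distr[OF *]) (auto simp: emeasure_density)
  also have "\<dots> = (\<integral>\<^sup>+ x. ennreal (h x (restr (shift_set (z x) D) \<mu>)) * indicator C (z x)
      \<partial>count_space (distinct_tuples \<mu>))"
    by (rule nn_integral_cong) (auto split: split_indicator)
  finally show ?thesis .
qed

text \<open>The points of a contributing tuple have to be seen through the window \<open>D + z(x)\<close>, so that \<open>h\<close>
  is only ever applied to tuples of points of its second argument. Without this, \<open>\<zeta>\<close> restricted to \<open>B\<close>
  need not be determined by \<open>\<xi>\<close> restricted to \<open>B + D\<close>, and the mixing coefficient of the pair
  \<open>B + D\<close>, \<open>B + A\<close> says nothing about \<open>\<zeta>\<close>: for a Poisson process, \<open>k = 1\<close>, \<open>h = 1\<close>, \<open>D = {0}\<close> and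
  \<open>z(x) = x + v\<close>, the Palm version at the origin is \<open>\<xi> + \<delta>\<^bsub>-v\<^esub>\<close>, although for small balls \<open>A\<close> around
  \<open>-v\<close> and \<open>B\<close> around \<open>0\<close> that coefficient vanishes.\<close>

definition tuples_in_window ::
  "'w measure \<Rightarrow> ('w \<Rightarrow> 'a::euclidean_space measure) \<Rightarrow>
   ('a ^ 'k \<Rightarrow> 'a measure \<Rightarrow> real) \<Rightarrow> ('a ^ 'k \<Rightarrow> 'a) \<Rightarrow> 'a set \<Rightarrow> bool"
where
  "tuples_in_window M \<xi> h z D \<longleftrightarrow>
     (AE \<omega> in M. \<forall>x\<in>distinct_tuples (\<xi> \<omega>).
        h x (restr (shift_set (z x) D) (\<xi> \<omega>)) = 1 \<longrightarrow> (\<forall>i. x $ i \<in> shift_set (z x) D))"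

definition intensity :: "'w measure \<Rightarrow> ('w \<Rightarrow> 'a::euclidean_space measure) \<Rightarrow> 'a measure" where
  "intensity M \<zeta> = measure_of UNIV (sets borel) (\<lambda>C. \<integral>\<^sup>+ \<omega>. emeasure (\<zeta> \<omega>) C \<partial>M)"

text \<open>Only the laws of the members \<open>\<Xi> x\<close> matter, so they are realised on one common probability
  space \<open>M'\<close>, which may differ from that of \<open>\<xi>\<close>. The measurability clause makes the outer integral
  on the right meaningful (on nonmeasurable functions \<^const>\<open>nn_integral\<close> is a lower integral); it
  holds automatically when \<open>\<Xi> x\<close> is the translate by \<open>x\<close> of one point process.\<close>

definition palm_version ::
  "'w measure \<Rightarrow> ('w \<Rightarrow> 'a::euclidean_space measure) \<Rightarrow> ('w \<Rightarrow> 'a measure) \<Rightarrow>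
   'v measure \<Rightarrow> ('a \<Rightarrow> 'v \<Rightarrow> 'a measure) \<Rightarrow> bool"
where
  "palm_version M \<xi> \<zeta> M' \<Xi> \<longleftrightarrow> prob_space M' \<and> (\<forall>x. point_process M' (\<Xi> x)) \<and>
     (\<forall>f :: 'a \<times> 'a measure \<Rightarrow> real.
        f \<in> borel_measurable (borel \<Otimes>\<^sub>M config_algebra) \<and> (\<forall>u. 0 \<le> f u) \<longrightarrow>
        (\<lambda>x. \<integral>\<^sup>+ \<omega>'. f (x, \<Xi> x \<omega>') \<partial>M') \<in> borel_measurable borel \<and>
        (\<integral>\<^sup>+ \<omega>. (\<integral>\<^sup>+ x. f (x, \<xi> \<omega>) \<partial>\<zeta> \<omega>) \<partial>M) =
        (\<integral>\<^sup>+ x. (\<integral>\<^sup>+ \<omega>'. f (x, \<Xi> x \<omega>') \<partial>M') \<partial>intensity M \<zeta>))"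

definition palm_version_origin ::
  "'w measure \<Rightarrow> ('w \<Rightarrow> 'a::euclidean_space measure) \<Rightarrow> ('w \<Rightarrow> 'a measure) \<Rightarrow>
   'v measure \<Rightarrow> ('v \<Rightarrow> 'a measure) \<Rightarrow> bool"
where
  "palm_version_origin M \<xi> \<zeta> M' \<xi>\<^sub>o \<longleftrightarrow>
     point_process M' \<xi>\<^sub>o \<and> palm_version M \<xi> \<zeta> M' (\<lambda>x \<omega>'. shift x (\<xi>\<^sub>o \<omega>'))"

definition d_TV ::
  "'w measure \<Rightarrow> ('w \<Rightarrow> 'a::euclidean_space measure) \<Rightarrow> 'v measure \<Rightarrow> ('v \<Rightarrow> 'a measure) \<Rightarrow> real"
where
  "d_TV M \<xi> M' \<xi>' =
     (SUP E \<in> sets config_algebra.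
        \<bar>measure (distr M config_algebra \<xi>) E - measure (distr M' config_algebra \<xi>') E\<bar>)"

text \<open>For finite measures \<open>P\<close>, \<open>Q\<close> on the same sigma-algebra: the total mass of the total variation
  measure of the signed measure \<open>P - Q\<close>, as a supremum over finite measurable partitions.\<close>

definition total_variation_mass :: "'b measure \<Rightarrow> 'b measure \<Rightarrow> real" where
  "total_variation_mass P Q =
     (SUP \<E> \<in> {\<E>. finite \<E> \<and> \<E> \<subseteq> sets P \<and> disjoint \<E> \<and> \<Union>\<E> = space P}.
        \<Sum>E\<in>\<E>. \<bar>measure P E - measure Q E\<bar>)"

text \<open>The sigma-algebra induced on the configurations contained in \<open>C\<close>.\<close>

definition config_algebra_on :: "'a::euclidean_space set \<Rightarrow> 'a measure measure" where
  "config_algebra_on C = restrict_space config_algebra {\<mu>. emeasure \<mu> (- C) = 0}"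

definition beta_mixing ::
  "'w measure \<Rightarrow> ('w \<Rightarrow> 'a::euclidean_space measure) \<Rightarrow> 'a set \<Rightarrow> 'a set \<Rightarrow> real"
where
  "beta_mixing M \<xi> A B =
     1 / 2 * total_variation_mass
       (distr M (config_algebra_on A \<Otimes>\<^sub>M config_algebra_on B) (\<lambda>\<omega>. (restr A (\<xi> \<omega>), restr B (\<xi> \<omega>))))
       (distr M (config_algebra_on A) (\<lambda>\<omega>. restr A (\<xi> \<omega>)) \<Otimes>\<^sub>M
        distr M (config_algebra_on B) (\<lambda>\<omega>. restr B (\<xi> \<omega>)))"

text \<open>Powers in \<open>[0, \<infinity>]\<close> with exponent \<open>a \<ge> 0\<close>, where \<open>\<infinity>\<^sup>a = \<infinity>\<close> for \<open>a > 0\<close>. Unlike for \<^const>\<open>powr\<close>,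
  the value at \<open>a = 0\<close> is \<open>1\<close> also for base \<open>0\<close>.\<close>

definition epowr :: "ennreal \<Rightarrow> real \<Rightarrow> ennreal" where
  "epowr x a = (if a = 0 then 1 else if x = \<top> then \<top> else ennreal (enn2real x powr a))"

end

theory Submission
  imports Defs
begin

text \<open>
  Write \<open>W = B + D\<close> and \<open>V = B + A\<close>, let \<open>P\<close> be the joint law of \<open>(\<xi>\<^bsub>W\<^esub>, \<xi>\<^bsub>V\<^esub>)\<close> and \<open>Q\<close> the product of its
  marginals, and fix an event \<open>E\<close>. Let \<open>g(\<mu>, \<nu>)\<close> be the number of points \<open>y\<close> in \<open>B\<close> of the tuple process of
  \<open>\<mu>\<close> for which \<open>\<nu>\<close>, seen from \<open>y\<close> through the window \<open>A\<close>, lies in \<open>E\<close>. Since the tuples that produce a point in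
  \<open>B\<close> lie in \<open>W\<close>, and since seeing \<open>A\<close> from a point of \<open>B\<close> only involves \<open>V\<close>, two identities hold:
  the Palm formula gives \<open>\<integral> g dP = E[\<zeta>](B) P(\<xi>\<^sup>o\<^bsub>A\<^esub> \<in> E)\<close>, and the stationarity of \<open>\<xi>\<close> gives
  \<open>\<integral> g dQ = E[\<zeta>](B) P(\<xi>\<^bsub>A\<^esub> \<in> E)\<close>. So the difference of the two probabilities is, up to the factor
  \<open>E[\<zeta>](B)\<close>, the integral of one function against \<open>P - Q\<close>
  (\<open>palm_mark_integral\<close>, \<open>stationary_mark_integral\<close>).

  Setwise \<open>P\<close> and \<open>Q\<close> differ by at most \<open>\<beta>\<close>, the mixing coefficient. The function \<open>g\<close> is unbounded, but
  it is dominated by \<open>\<zeta>(B)\<close>, which has the same \<open>p\<close>-th moment \<open>m\<close> under \<open>P\<close> and \<open>Q\<close>. Truncating \<open>g\<close> at a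
  level \<open>t\<close> costs \<open>m t\<^sup>1\<^sup>-\<^sup>p\<close>, and the truncated function contributes at most \<open>t \<beta>\<close>; the choice
  \<open>t = (m / \<beta>)\<^sup>1\<^sup>/\<^sup>p\<close> makes both terms equal to \<open>m\<^sup>1\<^sup>/\<^sup>p \<beta>\<^sup>1\<^sup>-\<^sup>1\<^sup>/\<^sup>p\<close>
  (\<open>nn_integral_le_of_setwise_close_moment\<close>). As \<open>\<beta> \<le> 1\<close>, the exponent may be lowered to
  \<open>1 - 1/p - 1/q\<close>.

  The remaining work is to see that \<open>g\<close> is measurable in \<open>(\<mu>, \<nu>)\<close>. A sum over the \<open>k\<close>-tuples of points of a
  simple configuration \<open>\<mu>\<close> is a \<open>k\<close>-fold iterated integral with respect to \<open>\<mu>\<close>, and integrals against a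
  measurably varying configuration are measurable in the parameter
  (\<open>measurable_nn_integral_config\<close>, \<open>measurable_distinct_tuple_sum\<close>).
\<close>

section \<open>Integrals against two setwise close laws\<close>

lemma borel_measurable_epowr [measurable]:
  assumes [measurable]: "f \<in> borel_measurable N"
  shows "(\<lambda>x. epowr (f x) a) \<in> borel_measurable N"
  unfolding epowr_def by measurable

lemma epowr_antimono_exponent:
  assumes "0 \<le> b" "b \<le> 1" "0 \<le> s" "s \<le> t"
  shows "epowr (ennreal b) t \<le> epowr (ennreal b) s"
proof (cases "t = 0")
  case False
  have "b powr t \<le> b powr s" using assms by (intro powr_mono') auto
  moreover have "b powr t \<le> 1" using assms False by (intro powr_le1) auto
  ultimately show ?thesis
    using assms False by (auto simp: epowr_def intro: ennreal_leI)
qed (use assms in simp)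

text \<open>
  On a Hahn set \<open>Y\<close>, where \<open>P\<close> exceeds \<open>Q\<close>, the nonnegative function \<open>t - u\<close> has the smaller integral
  under \<open>Q\<close>, which turns the excess of \<open>u\<close> into at most \<open>t (P(Y) - Q(Y))\<close>; off \<open>Y\<close> there is no excess.
\<close>

lemma nn_integral_le_of_setwise_close:
  assumes P: "prob_space P" and Q: "prob_space Q" and sets: "sets P = sets Q"
    and close: "\<And>X. X \<in> sets P \<Longrightarrow> \<bar>measure P X - measure Q X\<bar> \<le> b"
    and u[measurable]: "u \<in> borel_measurable P"
    and bound: "\<And>x. u x \<le> ennreal t" and t: "0 \<le> t"
  shows "(\<integral>\<^sup>+ x. u x \<partial>P) \<le> (\<integral>\<^sup>+ x. u x \<partial>Q) + ennreal (t * b)"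
proof -
  interpret P: prob_space P by fact
  interpret Q: prob_space Q by fact
  have sets' [measurable_cong, simp]: "sets Q = sets P" using sets by simp
  have space [simp]: "space Q = space P" using sets' by (rule sets_eq_imp_space_eq)
  obtain Y where Y[measurable]: "Y \<in> sets P"
    and QP: "\<And>X. X \<in> sets P \<Longrightarrow> X \<subseteq> Y \<Longrightarrow> emeasure Q X \<le> emeasure P X"
    and PQ: "\<And>X. X \<in> sets P \<Longrightarrow> X \<inter> Y = {} \<Longrightarrow> emeasure P X \<le> emeasure Q X"
    using finite_unsigned_Hahn_decomposition[of P Q] P.finite_measure_axioms Q.finite_measure_axioms
    by auto
  have on_Y: "(\<integral>\<^sup>+ x. v x * indicator Y x \<partial>Q) \<le> (\<integral>\<^sup>+ x. v x * indicator Y x \<partial>P)"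
    if [measurable]: "v \<in> borel_measurable P" for v
  proof -
    have "(\<integral>\<^sup>+ x. v x * indicator Y x \<partial>Q) = (\<integral>\<^sup>+ x. v x \<partial>density Q (indicator Y))"
      by (subst nn_integral_density) (auto simp: mult.commute)
    also have "\<dots> \<le> (\<integral>\<^sup>+ x. v x \<partial>density P (indicator Y))"
      by (rule nn_integral_mono_measure)
        (auto simp: le_measure emeasure_restricted intro!: QP)
    also have "\<dots> = (\<integral>\<^sup>+ x. v x * indicator Y x \<partial>P)"
      by (subst nn_integral_density) (auto simp: mult.commute)
    finally show ?thesis .
  qed
  have off_Y: "(\<integral>\<^sup>+ x. u x * indicator (space P - Y) x \<partial>P) \<le> (\<integral>\<^sup>+ x. u x * indicator (space P - Y) x \<partial>Q)"
  proof -
    have "(\<integral>\<^sup>+ x. u x * indicator (space P - Y) x \<partial>P) = (\<integral>\<^sup>+ x. u x \<partial>density P (indicator (space P - Y)))"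
      by (subst nn_integral_density) (auto simp: mult.commute)
    also have "\<dots> \<le> (\<integral>\<^sup>+ x. u x \<partial>density Q (indicator (space P - Y)))"
      by (rule nn_integral_mono_measure)
        (auto simp: le_measure emeasure_restricted intro!: PQ)
    also have "\<dots> = (\<integral>\<^sup>+ x. u x * indicator (space P - Y) x \<partial>Q)"
      by (subst nn_integral_density) (auto simp: mult.commute)
    finally show ?thesis .
  qed
  have split: "(\<integral>\<^sup>+ x. u x \<partial>R) = (\<integral>\<^sup>+ x. u x * indicator Y x \<partial>R) + (\<integral>\<^sup>+ x. u x * indicator (space P - Y) x \<partial>R)"
    if [measurable_cong]: "sets R = sets P" for R
  proof -
    have "space R = space P" using that by (rule sets_eq_imp_space_eq)
    then have "(\<integral>\<^sup>+ x. u x \<partial>R) = (\<integral>\<^sup>+ x. u x * indicator Y x + u x * indicator (space P - Y) x \<partial>R)"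
      by (intro nn_integral_cong) (auto split: split_indicator)
    also have "\<dots> = (\<integral>\<^sup>+ x. u x * indicator Y x \<partial>R) + (\<integral>\<^sup>+ x. u x * indicator (space P - Y) x \<partial>R)"
      by (rule nn_integral_add) auto
    finally show ?thesis .
  qed
  have compl: "(\<integral>\<^sup>+ x. (ennreal t - u x) * indicator Y x \<partial>R) + (\<integral>\<^sup>+ x. u x * indicator Y x \<partial>R) = ennreal t * emeasure R Y"
    if [measurable_cong]: "sets R = sets P" for R
  proof -
    have [measurable]: "Y \<in> sets R" using that by simp
    have "(\<integral>\<^sup>+ x. (ennreal t - u x) * indicator Y x \<partial>R) + (\<integral>\<^sup>+ x. u x * indicator Y x \<partial>R)
      = (\<integral>\<^sup>+ x. (ennreal t - u x) * indicator Y x + u x * indicator Y x \<partial>R)"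
      by (rule nn_integral_add[symmetric]) auto
    also have "\<dots> = (\<integral>\<^sup>+ x. ennreal t * indicator Y x \<partial>R)"
      using bound by (intro nn_integral_cong) (auto split: split_indicator simp: diff_add_cancel_ennreal)
    also have "\<dots> = ennreal t * emeasure R Y"
      by (rule nn_integral_cmult_indicator) simp
    finally show ?thesis .
  qed
  let ?I = "\<lambda>R. \<integral>\<^sup>+ x. u x * indicator Y x \<partial>R" and ?J = "\<lambda>R. \<integral>\<^sup>+ x. (ennreal t - u x) * indicator Y x \<partial>R"
  have J: "?J Q \<le> ?J P" by (rule on_Y) simp
  have eqP: "?J P + ?I P = ennreal (t * measure P Y)"
    using compl[of P] t by (simp add: P.emeasure_eq_measure ennreal_mult')
  have eqQ: "?J Q + ?I Q = ennreal (t * measure Q Y)"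
    using compl[of Q] t by (simp add: Q.emeasure_eq_measure ennreal_mult')
  have fin: "?J P < \<top>" "?I P < \<top>" "?J Q < \<top>" "?I Q < \<top>"
    using ennreal_less_top[of "t * measure P Y"] ennreal_less_top[of "t * measure Q Y"]
    unfolding eqP[symmetric] eqQ[symmetric] by (auto simp: less_top)
  define jP iP jQ iQ where "jP = enn2real (?J P)" and "iP = enn2real (?I P)"
    and "jQ = enn2real (?J Q)" and "iQ = enn2real (?I Q)"
  then have r: "?J P = ennreal jP" "?I P = ennreal iP" "?J Q = ennreal jQ" "?I Q = ennreal iQ"
    and nn: "0 \<le> jP" "0 \<le> iP" "0 \<le> jQ" "0 \<le> iQ"
    using fin by auto
  have PY: "measure P Y \<le> measure Q Y + b" and b: "0 \<le> b"
    using close[OF Y] by linarith+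
  have "jQ \<le> jP" using J nn unfolding r by simp
  moreover have "jP + iP = t * measure P Y"
    using eqP nn t unfolding r by (simp flip: ennreal_plus)
  moreover have "jQ + iQ = t * measure Q Y"
    using eqQ nn t unfolding r by (simp flip: ennreal_plus)
  moreover have "t * measure P Y \<le> t * measure Q Y + t * b"
    using mult_left_mono[OF PY t] by (simp add: distrib_left)
  ultimately have "iP \<le> iQ + t * b" by linarith
  then have "?I P \<le> ?I Q + ennreal (t * b)"
    unfolding r using nn b t by (simp flip: ennreal_plus)
  from add_mono[OF this off_Y] show ?thesis
    by (subst split[of P, OF refl], subst split[of Q, OF sets']) (simp only: ac_simps)
qed

text \<open>
  Where \<open>g\<close> exceeds the level \<open>t\<close>, so does \<open>w\<close>, and then, if \<open>w\<close> is finite,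
  \<open>w = w\<^sup>p w\<^sup>1\<^sup>-\<^sup>p \<le> w\<^sup>p t\<^sup>1\<^sup>-\<^sup>p\<close>.
\<close>

lemma le_min_add_epowr:
  assumes "g \<le> w" and t: "0 < t" and p: "1 < p"
  shows "g \<le> min g (ennreal t) + epowr w p * ennreal (t powr (1 - p))"
proof (cases "g \<le> ennreal t")
  case False
  show ?thesis
  proof (cases "w = \<top>")
    case True
    then show ?thesis using t p by (simp add: epowr_def ennreal_top_mult)
  next
    case w: False
    then obtain r where r: "w = ennreal r" "0 \<le> r" by (metis ennreal_cases)
    have "ennreal t < ennreal r" using False assms(1) r by auto
    then have tr: "t < r" using t by (simp add: ennreal_less_iff)
    have "r = r powr p * r powr (1 - p)"
      using tr t by (simp add: powr_add[symmetric])
    also have "\<dots> \<le> r powr p * t powr (1 - p)"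
      using tr t p by (intro mult_left_mono powr_mono2') auto
    finally have "g \<le> epowr w p * ennreal (t powr (1 - p))"
      using assms(1) p r by (auto simp: epowr_def ennreal_mult''[symmetric] intro: order_trans ennreal_leI)
    then show ?thesis by (simp add: add_increasing)
  qed
qed auto

text \<open>
  A substitute for Hoelder's inequality with respect to the total variation measure of \<open>P - Q\<close>: split
  \<open>g\<close> at a level \<open>t\<close>. The moment is only taken under \<open>P\<close>, because only the integral over \<open>P\<close> is split.
\<close>

lemma nn_integral_le_of_setwise_close_moment:
  assumes P: "prob_space P" and Q: "prob_space Q" and sets: "sets P = sets Q"
    and close: "\<And>X. X \<in> sets P \<Longrightarrow> \<bar>measure P X - measure Q X\<bar> \<le> b"
    and g[measurable]: "g \<in> borel_measurable P" and w[measurable]: "w \<in> borel_measurable P"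
    and gw: "\<And>x. g x \<le> w x" and p: "1 < p"
  shows "(\<integral>\<^sup>+ x. g x \<partial>P) \<le> (\<integral>\<^sup>+ x. g x \<partial>Q) +
     2 * epowr (\<integral>\<^sup>+ x. epowr (w x) p \<partial>P) (1 / p) * epowr (ennreal b) (1 - 1 / p)"
proof -
  define m where "m = (\<integral>\<^sup>+ x. epowr (w x) p \<partial>P)"
  have [measurable_cong]: "sets Q = sets P" using sets by simp
  have b: "0 \<le> b" using close[of "{}"] by auto
  have p': "p > 0" "1 - 1 / p \<noteq> 0" "1 - 1/p > 0" using p by auto
  consider "m = 0" | "b = 0" | "b > 0" "m = \<top>" | "b > 0" "0 < m" "m < \<top>"
    using b by (metis less_eq_real_def top.not_eq_extremum zero_less_iff_neq_zero)
  then show ?thesis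
  proof cases
    case 1
    then have "AE x in P. epowr (w x) p = 0"
      unfolding m_def by (subst (asm) nn_integral_0_iff_AE) auto
    then have "AE x in P. g x = 0"
    proof eventually_elim
      fix x assume "epowr (w x) p = 0"
      then have "w x = 0" using p by (auto simp: epowr_def enn2real_eq_0_iff split: if_splits)
      then show "g x = 0" using gw[of x] by simp
    qed
    then have "(\<integral>\<^sup>+ x. g x \<partial>P) = 0" by (subst nn_integral_0_iff_AE) auto
    then show ?thesis by simp
  next
    case 2
    interpret P: prob_space P by fact
    interpret Q: prob_space Q by fact
    have "P = Q"
    proof (rule measure_eqI[OF sets])
      fix X assume "X \<in> sets P"
      then have "measure P X = measure Q X" using close[of X] 2 by linarith
      then show "emeasure P X = emeasure Q X"
        unfolding P.emeasure_eq_measure Q.emeasure_eq_measure by simp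
    qed
    then show ?thesis by simp
  next
    case 3
    \<comment> \<open>The bound is infinite, as the second factor is positive.\<close>
    have "epowr m (1 / p) = \<top>" using 3 p by (simp add: epowr_def)
    moreover have "epowr (ennreal b) (1 - 1 / p) \<noteq> 0"
      using 3(1) p'(2) by (simp add: epowr_def)
    ultimately show ?thesis
      unfolding m_def[symmetric] by (simp add: ennreal_mult_top ennreal_top_mult)
  next
    case 4
    obtain r where r: "m = ennreal r" "r > 0"
      using 4 by (metis ennreal_cases ennreal_less_zero_iff less_irrefl top.not_eq_extremum)
    \<comment> \<open>This level makes the truncated part \<open>t * b\<close> and the tail \<open>r * t powr (1 - p)\<close> equal.\<close>
    define t where "t = (r / b) powr (1 / p)"
    have t: "t > 0" using r 4 by (simp add: t_def)
    have tb: "t * b = r powr (1 / p) * b powr (1 - 1 / p)"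
      using r 4 by (simp add: t_def powr_divide powr_diff)
    have tr: "r * t powr (1 - p) = r powr (1 / p) * b powr (1 - 1 / p)"
    proof -
      have "t powr (1 - p) = (r / b) powr (1 / p - 1)"
        unfolding t_def powr_powr using p by (simp add: field_simps)
      also have "\<dots> = r powr (1 / p - 1) * b powr (1 - 1 / p)"
        using r 4 powr_minus_divide[of b "1 / p - 1"] by (simp add: powr_divide)
      also have "r * \<dots> = r powr (1 / p) * b powr (1 - 1 / p)"
        using r powr_add[of r 1 "1 / p - 1"] by simp
      finally show ?thesis .
    qed
    have "(\<integral>\<^sup>+ x. g x \<partial>P) \<le> (\<integral>\<^sup>+ x. min (g x) (ennreal t) + epowr (w x) p * ennreal (t powr (1 - p)) \<partial>P)"
      by (intro nn_integral_mono le_min_add_epowr gw t p)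
    also have "\<dots> = (\<integral>\<^sup>+ x. min (g x) (ennreal t) \<partial>P) + m * ennreal (t powr (1 - p))"
      unfolding m_def by (subst nn_integral_add) (auto simp: nn_integral_multc)
    also have "(\<integral>\<^sup>+ x. min (g x) (ennreal t) \<partial>P) \<le> (\<integral>\<^sup>+ x. min (g x) (ennreal t) \<partial>Q) + ennreal (t * b)"
      using t by (intro nn_integral_le_of_setwise_close P Q sets close) auto
    also have "(\<integral>\<^sup>+ x. min (g x) (ennreal t) \<partial>Q) \<le> (\<integral>\<^sup>+ x. g x \<partial>Q)"
      by (intro nn_integral_mono) auto
    also have "m * ennreal (t powr (1 - p)) = ennreal (r powr (1 / p) * b powr (1 - 1 / p))"
      using r by (simp add: ennreal_mult''[symmetric] tr)
    also have "ennreal (t * b) = ennreal (r powr (1 / p) * b powr (1 - 1 / p))"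
      by (simp add: tb)
    also have "ennreal (r powr (1 / p) * b powr (1 - 1 / p)) = epowr m (1 / p) * epowr (ennreal b) (1 - 1 / p)"
      using r b p p' by (simp add: epowr_def ennreal_mult)
    finally show ?thesis
      unfolding m_def[symmetric] by (simp add: add_mono mult_2 distrib_right add.assoc)
  qed
qed

lemma sum_abs_measure_diff_le_2:
  assumes "prob_space P" "prob_space Q" "sets P = sets Q"
    and "finite \<E>" "\<E> \<subseteq> sets P" "disjoint \<E>"
  shows "(\<Sum>E\<in>\<E>. \<bar>measure P E - measure Q E\<bar>) \<le> 2"
proof -
  interpret P: prob_space P by fact
  interpret Q: prob_space Q by fact
  have disj: "disjoint_family_on (\<lambda>E. E) \<E>"
    using assms(6) by (auto simp: disjoint_family_on_def disjoint_def)
  have "(\<Sum>E\<in>\<E>. \<bar>measure P E - measure Q E\<bar>) \<le> (\<Sum>E\<in>\<E>. measure P E + measure Q E)"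
    by (intro sum_mono) (auto simp: abs_if)
  also have "\<dots> = measure P (\<Union>\<E>) + measure Q (\<Union>\<E>)"
    using assms disj P.finite_measure_finite_Union[of \<E> "\<lambda>E. E"] Q.finite_measure_finite_Union[of \<E> "\<lambda>E. E"]
    by (simp add: sum.distrib)
  also have "\<dots> \<le> 1 + 1"
    by (intro add_mono P.prob_le_1 Q.prob_le_1)
  finally show ?thesis by simp
qed

text \<open>
  The partition into \<open>X\<close> and its complement shows a discrepancy on \<open>X\<close> twice, since both laws have mass one;
  this is the factor \<open>1 / 2\<close> in the mixing coefficient.
\<close>

lemma total_variation_mass_bounds:
  assumes P: "prob_space P" and Q: "prob_space Q" and sets: "sets P = sets Q"
  shows setwise_diff_le_total_variation_mass:
      "X \<in> sets P \<Longrightarrow> \<bar>measure P X - measure Q X\<bar> \<le> 1 / 2 * total_variation_mass P Q"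
    and total_variation_mass_le_2: "total_variation_mass P Q \<le> 2"
proof -
  interpret P: prob_space P by fact
  interpret Q: prob_space Q by fact
  let ?part = "{\<E>. finite \<E> \<and> \<E> \<subseteq> sets P \<and> disjoint \<E> \<and> \<Union>\<E> = space P}"
  have bdd: "bdd_above ((\<lambda>\<E>. \<Sum>E\<in>\<E>. \<bar>measure P E - measure Q E\<bar>) ` ?part)"
    using sum_abs_measure_diff_le_2[OF assms] by (auto intro!: bdd_aboveI)
  have "{space P} \<in> ?part" by (auto simp: disjoint_def)
  then have "?part \<noteq> {}" by blast
  then show "total_variation_mass P Q \<le> 2"
    unfolding total_variation_mass_def
    by (rule cSUP_least) (use sum_abs_measure_diff_le_2[OF assms] in auto)
  assume X: "X \<in> sets P"
  let ?E = "{X, space P - X}"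
  have "?E \<in> ?part" using X sets.sets_into_space[OF X] by (auto simp: disjoint_def)
  then have le: "(\<Sum>E\<in>?E. \<bar>measure P E - measure Q E\<bar>) \<le> total_variation_mass P Q"
    unfolding total_variation_mass_def by (intro cSUP_upper bdd)
  have ne: "X \<noteq> space P - X" using P.not_empty sets.sets_into_space[OF X] by blast
  have "measure Q (space P - X) = 1 - measure Q X"
    using Q.prob_compl[of X] X by (simp add: sets sets_eq_imp_space_eq[OF sets])
  then show "\<bar>measure P X - measure Q X\<bar> \<le> 1 / 2 * total_variation_mass P Q"
    using le ne X by (simp add: P.prob_compl abs_minus_commute)
qed

section \<open>Restriction and translation of configurations\<close>

lemma counting_measuresD:
  assumes "\<mu> \<in> counting_measures"
  shows "sets \<mu> = sets borel" "space \<mu> = UNIV"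
    "C \<in> sets borel \<Longrightarrow> emeasure \<mu> C \<in> range ennreal_of_enat"
    "compact K \<Longrightarrow> emeasure \<mu> K < \<top>"
  using assms sets_eq_imp_space_eq[of \<mu> borel] by (auto simp: counting_measures_def)

lemma emeasure_bounded_finite:
  assumes "\<mu> \<in> counting_measures" "bounded S"
  shows "emeasure \<mu> S < \<top>"
proof -
  have "compact (closure S)" using assms by simp
  then have "emeasure \<mu> (closure S) < \<top>" using counting_measuresD(4)[OF assms(1)] by blast
  moreover have "emeasure \<mu> S \<le> emeasure \<mu> (closure S)"
    using counting_measuresD(1)[OF assms(1)] closure_subset by (intro emeasure_mono) auto
  ultimately show ?thesis by simp
qed

lemma measurable_config_algebra:
  assumes "\<And>x. x \<in> space N \<Longrightarrow> K x \<in> counting_measures"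
    and "\<And>C. C \<in> sets borel \<Longrightarrow> (\<lambda>x. emeasure (K x) C) \<in> borel_measurable N"
  shows "K \<in> N \<rightarrow>\<^sub>M config_algebra"
  unfolding config_algebra_def using assms
  by (auto intro!: measurable_Sup2 measurable_vimage_algebra2)

lemma measurable_emeasure_config [measurable (raw)]:
  assumes "K \<in> N \<rightarrow>\<^sub>M config_algebra" "C \<in> sets borel"
  shows "(\<lambda>x. emeasure (K x) C) \<in> borel_measurable N"
  using measurable_compose[OF assms(1) measurable_emeasure_config_algebra[OF assms(2)]] .

lemma sets_restr [simp]: "sets (restr C \<mu>) = sets \<mu>"
  by (simp add: restr_def)

lemma emeasure_restr:
  assumes "sets \<mu> = sets borel" "C \<in> sets borel" "S \<in> sets borel"
  shows "emeasure (restr C \<mu>) S = emeasure \<mu> (C \<inter> S)"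
  unfolding restr_def using assms by (intro emeasure_restricted) auto

lemma sets_shift [simp]: "sets (shift y \<mu>) = sets borel"
  by (simp add: shift_def)

lemma emeasure_shift:
  assumes "sets \<mu> = sets borel" "S \<in> sets borel"
  shows "emeasure (shift y \<mu>) S = emeasure \<mu> ((\<lambda>x. x + y) -` S)"
proof -
  have "(\<lambda>x. x + y) \<in> \<mu> \<rightarrow>\<^sub>M borel" using assms(1) by (simp cong: measurable_cong_sets)
  then show ?thesis
    using assms sets_eq_imp_space_eq[OF assms(1)] by (simp add: shift_def emeasure_distr)
qed

lemma mem_shift_set: "u \<in> shift_set y S \<longleftrightarrow> u - y \<in> S"
  unfolding shift_set_def image_iff by (metis add_diff_cancel diff_add_cancel)

lemma vimage_add_borel: "S \<in> sets borel \<Longrightarrow> (\<lambda>x. x + y) -` S \<in> sets (borel :: 'a::euclidean_space measure)"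
  using measurable_sets[of "\<lambda>x. x + y" borel borel S] by simp

lemma shift_set_borel: "S \<in> sets borel \<Longrightarrow> shift_set y S \<in> sets (borel :: 'a::euclidean_space measure)"
proof -
  assume S: "S \<in> sets borel"
  have "shift_set y S = (\<lambda>x. x + (- y)) -` S"
    by (auto simp: mem_shift_set)
  then show ?thesis using vimage_add_borel[OF S, of "- y"] by simp
qed

lemma restr_counting:
  assumes \<mu>: "\<mu> \<in> counting_measures" and C: "C \<in> sets borel"
  shows "restr C \<mu> \<in> counting_measures"
proof -
  note s = counting_measuresD[OF \<mu>]
  have "emeasure (restr C \<mu>) K < \<top>" if "compact K" for K
    using that emeasure_bounded_finite[OF \<mu>, of "C \<inter> K"] s C
    by (simp add: emeasure_restr compact_imp_bounded bounded_Int borel_compact)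
  then show ?thesis
    using s C by (auto simp: counting_measures_def emeasure_restr)
qed

lemma shift_counting:
  assumes \<mu>: "\<mu> \<in> counting_measures"
  shows "shift y \<mu> \<in> counting_measures"
proof -
  note s = counting_measuresD[OF \<mu>]
  have "emeasure (shift y \<mu>) K < \<top>" if "compact K" for K
  proof -
    have "(\<lambda>x. x + y) -` K = (\<lambda>x. x + (- y)) ` K"
      by (auto simp: image_iff) (metis add_diff_cancel)
    moreover have "bounded ((\<lambda>x. x + (- y)) ` K)"
      using that by (simp add: bounded_translation_minus compact_imp_bounded)
    ultimately show ?thesis
      using that emeasure_bounded_finite[OF \<mu>] s(1) by (simp add: emeasure_shift borel_compact)
  qed
  then show ?thesis
    using s by (auto simp: counting_measures_def emeasure_shift vimage_add_borel)
qed

lemma restr_restr: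
  assumes "sets \<mu> = sets borel" "C \<in> sets borel" "C' \<in> sets borel" "C \<subseteq> C'"
  shows "restr C (restr C' \<mu>) = restr C \<mu>"
proof (rule measure_eqI)
  fix S assume "S \<in> sets (restr C (restr C' \<mu>))"
  then have S: "S \<in> sets borel" using assms(1) by simp
  have "C' \<inter> (C \<inter> S) = C \<inter> S" using assms(4) by blast
  then show "emeasure (restr C (restr C' \<mu>)) S = emeasure (restr C \<mu>) S"
    using assms(1-3) S by (simp add: emeasure_restr)
qed simp

lemma shift_minus_shift:
  assumes "sets \<mu> = sets borel"
  shows "shift (- y) (shift y \<mu>) = \<mu>"
  using assms by (intro measure_eqI) (auto simp: emeasure_shift vimage_add_borel vimage_def)

text \<open>
  Seen from \<open>y\<close> through the window \<open>A\<close>, only the part of a configuration in \<open>A + y\<close> is visible.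
\<close>

lemma restr_shift_restr:
  assumes "sets \<mu> = sets borel" "A \<in> sets borel" "W \<in> sets borel" "\<And>a. a \<in> A \<Longrightarrow> a + y \<in> W"
  shows "restr A (shift (- y) (restr W \<mu>)) = restr A (shift (- y) \<mu>)"
proof (rule measure_eqI)
  fix S assume "S \<in> sets (restr A (shift (- y) (restr W \<mu>)))"
  then have S: "S \<in> sets borel" by simp
  have "W \<inter> (\<lambda>x. x + - y) -` (A \<inter> S) = (\<lambda>x. x + - y) -` (A \<inter> S)"
    using assms(4) by force
  then show "emeasure (restr A (shift (- y) (restr W \<mu>))) S = emeasure (restr A (shift (- y) \<mu>)) S"
    using assms S vimage_add_borel[of "A \<inter> S" "- y"] by (simp add: emeasure_restr emeasure_shift del: vimage_Int)
qed simp

section \<open>Integrals against a measurably varying configuration\<close>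

text \<open>
  Normalised to mass one on a ball of radius \<open>n\<close>, the configuration becomes a subprobability kernel, for which
  this measurability is known. Undoing the normalisation, which is harmless because the mass of a ball is finite,
  gives the integral over the ball, and the balls exhaust the space.
\<close>

lemma measurable_nn_integral_config:
  fixes f :: "'b \<Rightarrow> 'a::euclidean_space \<Rightarrow> ennreal"
  assumes f[measurable]: "(\<lambda>(x, y). f x y) \<in> borel_measurable (N \<Otimes>\<^sub>M borel)"
    and K[measurable]: "K \<in> N \<rightarrow>\<^sub>M config_algebra"
  shows "(\<lambda>x. \<integral>\<^sup>+ y. f x y \<partial>K x) \<in> borel_measurable N"
proof -
  have count: "K x \<in> counting_measures" if "x \<in> space N" for x
    using measurable_space[OF K that] by (simp add: space_config_algebra)
  let ?C = "\<lambda>n::nat. cball (0::'a) (real n)"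
  define c where "c n x = emeasure (K x) (?C n)" for n x
  have c[measurable]: "c n \<in> borel_measurable N" for n
    unfolding c_def by measurable
  define L where "L n x = density (K x) (\<lambda>y. indicator (?C n) y * inverse (c n x))" for n x
  have dens: "(\<lambda>y. indicator (?C n) y * inverse (c n x)) \<in> borel_measurable (K x)"
    if "x \<in> space N" for n x
    by (subst measurable_cong_sets[OF counting_measuresD(1)[OF count[OF that]] refl])
      (intro borel_measurable_times_ennreal borel_measurable_indicator measurable_const; simp)
  have emL: "emeasure (L n x) S = emeasure (K x) (?C n \<inter> S) * inverse (c n x)"
    if "x \<in> space N" "S \<in> sets borel" for n x S
  proof -
    note s = counting_measuresD[OF count[OF that(1)]]
    note s(1)[measurable_cong]
    have "emeasure (L n x) S = (\<integral>\<^sup>+ y. inverse (c n x) * indicator (?C n \<inter> S) y \<partial>K x)"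
      unfolding L_def using that s(1) dens[OF that(1)]
      by (subst emeasure_density) (auto intro!: nn_integral_cong split: split_indicator)
    also have "\<dots> = inverse (c n x) * emeasure (K x) (?C n \<inter> S)"
      using that s(1) by (intro nn_integral_cmult_indicator) auto
    finally show ?thesis by (simp add: mult.commute)
  qed
  have [measurable]: "L n \<in> N \<rightarrow>\<^sub>M subprob_algebra borel" for n
  proof (rule measurable_subprob_algebra)
    fix x assume x: "x \<in> space N"
    note s = counting_measuresD[OF count[OF x]]
    show "sets (L n x) = sets borel" by (simp add: L_def s(1,2))
    show "subprob_space (L n x)"
    proof
      have "space (L n x) = UNIV" by (simp add: L_def s(1,2))
      then have "emeasure (L n x) (space (L n x)) = c n x * inverse (c n x)"
        using emL[OF x, of UNIV n] by (simp add: c_def)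
      also have "\<dots> \<le> 1"
      proof (cases "c n x = 0")
        case False
        then show ?thesis
          using s(4)[of "?C n"] ennreal_divide_self[of "c n x"] unfolding divide_ennreal_def c_def by simp
      qed simp
      finally show "emeasure (L n x) (space (L n x)) \<le> 1" .
      show "space (L n x) \<noteq> {}" by (simp add: L_def s(1,2))
    qed
  next
    fix S :: "'a set" assume S[measurable]: "S \<in> sets borel"
    have "(\<lambda>x. emeasure (K x) (?C n \<inter> S) * inverse (c n x)) \<in> borel_measurable N"
      by measurable
    then show "(\<lambda>x. emeasure (L n x) S) \<in> borel_measurable N"
      using emL S by (subst measurable_cong) auto
  qed
  have "(\<lambda>x. SUP n. c n x * (\<integral>\<^sup>+ y. f x y \<partial>L n x)) \<in> borel_measurable N"
  proof (rule borel_measurable_SUP)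
    fix n
    have "(\<lambda>x. \<integral>\<^sup>+ y. f x y \<partial>L n x) \<in> borel_measurable N"
      by (rule nn_integral_measurable_subprob_algebra2[where N=borel]) auto
    then show "(\<lambda>x. c n x * (\<integral>\<^sup>+ y. f x y \<partial>L n x)) \<in> borel_measurable N"
      by (rule borel_measurable_times_ennreal[OF c])
  qed simp
  moreover have "(SUP n. c n x * (\<integral>\<^sup>+ y. f x y \<partial>L n x)) = (\<integral>\<^sup>+ y. f x y \<partial>K x)" if x: "x \<in> space N" for x
  proof -
    note s = counting_measuresD[OF count[OF x]]
    note s(1)[measurable_cong]
    have fx[measurable]: "f x \<in> borel_measurable borel"
      using measurable_compose[OF measurable_Pair1'[OF x] f] by simp
    have mK: "k \<in> borel_measurable (K x)" if "k \<in> borel_measurable borel" for k :: "'a \<Rightarrow> ennreal"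
      using that by (simp cong: measurable_cong_sets add: s(1))
    have on_ball: "c n x * (\<integral>\<^sup>+ y. f x y \<partial>L n x) = (\<integral>\<^sup>+ y. f x y * indicator (?C n) y \<partial>K x)" for n
    proof (cases "c n x = 0")
      case True
      then have "AE y in K x. y \<notin> ?C n"
        unfolding c_def by (intro AE_not_in) (simp add: null_sets_def s(1))
      then have "(\<integral>\<^sup>+ y. f x y * indicator (?C n) y \<partial>K x) = 0"
        by (intro nn_integral_zero') (auto elim!: eventually_mono)
      then show ?thesis using True by simp
    next
      case False
      have "c n x < \<top>" using s(4)[of "?C n"] by (simp add: c_def)
      then have one: "c n x * inverse (c n x) = 1"
        using False ennreal_divide_self[of "c n x"] unfolding divide_ennreal_def by simp
      have "c n x * (\<integral>\<^sup>+ y. f x y \<partial>L n x) = c n x * (\<integral>\<^sup>+ y. (indicator (?C n) y * inverse (c n x)) * f x y \<partial>K x)"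
        unfolding L_def by (subst nn_integral_density[OF dens[OF x]]) auto
      also have "\<dots> = (\<integral>\<^sup>+ y. c n x * ((indicator (?C n) y * inverse (c n x)) * f x y) \<partial>K x)"
        using dens[OF x] by (intro nn_integral_cmult[symmetric] borel_measurable_times_ennreal[OF _ mK[OF fx]]) simp
      also have "\<dots> = (\<integral>\<^sup>+ y. f x y * indicator (?C n) y \<partial>K x)"
        using one by (intro nn_integral_cong) (auto split: split_indicator simp: mult.assoc[symmetric])
      finally show ?thesis .
    qed
    have "(SUP n. \<integral>\<^sup>+ y. f x y * indicator (?C n) y \<partial>K x) = (\<integral>\<^sup>+ y. (SUP n. f x y * indicator (?C n) y) \<partial>K x)"
      by (rule nn_integral_monotone_convergence_SUP[symmetric])
        (auto simp: incseq_def le_fun_def split: split_indicator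
          intro!: mK borel_measurable_times_ennreal[OF fx] borel_measurable_indicator)
    also have "\<dots> = (\<integral>\<^sup>+ y. f x y \<partial>K x)"
    proof (intro nn_integral_cong)
      fix y :: 'a
      obtain n where "norm y \<le> real n" using real_arch_simple by blast
      then have "f x y \<le> (SUP n. f x y * indicator (?C n) y)"
        by (intro SUP_upper2[of n]) auto
      then show "(SUP n. f x y * indicator (?C n) y) = f x y"
        by (intro antisym SUP_least) (auto split: split_indicator)
    qed
    finally show ?thesis unfolding on_ball .
  qed
  ultimately show ?thesis by (subst measurable_cong[symmetric]) auto
qed

text \<open>
  Evaluated on a set, the restriction to a moving window is an integral of a jointly measurable function against
  the configuration; the same holds for a moving translation.
\<close>

lemma measurable_restr_moving:
  fixes K :: "'b \<Rightarrow> 'a::euclidean_space measure"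
  assumes W: "W \<in> sets borel" and y[measurable]: "y \<in> borel_measurable N"
    and K[measurable]: "K \<in> N \<rightarrow>\<^sub>M config_algebra"
  shows "(\<lambda>x. restr (shift_set (y x) W) (K x)) \<in> N \<rightarrow>\<^sub>M config_algebra"
proof (rule measurable_config_algebra)
  have count: "K x \<in> counting_measures" if "x \<in> space N" for x
    using measurable_space[OF K that] by (simp add: space_config_algebra)
  show "restr (shift_set (y x) W) (K x) \<in> counting_measures" if "x \<in> space N" for x
    using that by (intro restr_counting count shift_set_borel W)
  fix S :: "'a set" assume S[measurable]: "S \<in> sets borel"
  note W[measurable]
  have "emeasure (restr (shift_set (y x) W) (K x)) S = (\<integral>\<^sup>+ u. indicator W (u - y x) * indicator S u \<partial>K x)"
    if x: "x \<in> space N" for x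
  proof -
    note s = counting_measuresD[OF count[OF x]]
    have "emeasure (restr (shift_set (y x) W) (K x)) S = emeasure (K x) (shift_set (y x) W \<inter> S)"
      using s by (intro emeasure_restr shift_set_borel W S)
    also have "\<dots> = (\<integral>\<^sup>+ u. indicator (shift_set (y x) W \<inter> S) u \<partial>K x)"
      using s(1,2) by (intro nn_integral_indicator[symmetric]) (simp add: shift_set_borel W sets.Int)
    also have "\<dots> = (\<integral>\<^sup>+ u. indicator W (u - y x) * indicator S u \<partial>K x)"
      by (intro nn_integral_cong) (auto split: split_indicator simp: mem_shift_set)
    finally show ?thesis .
  qed
  moreover have "(\<lambda>x. \<integral>\<^sup>+ u. indicator W (u - y x) * indicator S u \<partial>K x) \<in> borel_measurable N"
    by (rule measurable_nn_integral_config) (auto simp: split_beta')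
  ultimately show "(\<lambda>x. emeasure (restr (shift_set (y x) W) (K x)) S) \<in> borel_measurable N"
    by (subst measurable_cong) auto
qed

lemma measurable_shift_moving:
  fixes K :: "'b \<Rightarrow> 'a::euclidean_space measure"
  assumes y[measurable]: "y \<in> borel_measurable N"
    and K[measurable]: "K \<in> N \<rightarrow>\<^sub>M config_algebra"
  shows "(\<lambda>x. shift (y x) (K x)) \<in> N \<rightarrow>\<^sub>M config_algebra"
proof (rule measurable_config_algebra)
  have count: "K x \<in> counting_measures" if "x \<in> space N" for x
    using measurable_space[OF K that] by (simp add: space_config_algebra)
  show "shift (y x) (K x) \<in> counting_measures" if "x \<in> space N" for x
    using that by (intro shift_counting count)
  fix S :: "'a set" assume S[measurable]: "S \<in> sets borel"
  have "emeasure (shift (y x) (K x)) S = (\<integral>\<^sup>+ u. indicator S (u + y x) \<partial>K x)" if x: "x \<in> space N" for x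
  proof -
    note s = counting_measuresD[OF count[OF x]]
    have "emeasure (shift (y x) (K x)) S = (\<integral>\<^sup>+ u. indicator ((\<lambda>u. u + y x) -` S) u \<partial>K x)"
      using s(1) vimage_add_borel[OF S] by (subst nn_integral_indicator) (simp_all add: emeasure_shift)
    then show ?thesis by (simp add: indicator_def)
  qed
  moreover have "(\<lambda>x. \<integral>\<^sup>+ u. indicator S (u + y x) \<partial>K x) \<in> borel_measurable N"
    by (rule measurable_nn_integral_config) (auto simp: split_beta')
  ultimately show "(\<lambda>x. emeasure (shift (y x) (K x)) S) \<in> borel_measurable N"
    by (subst measurable_cong) auto
qed

lemma measurable_restr:
  fixes K :: "'b \<Rightarrow> 'a::euclidean_space measure"
  assumes C: "C \<in> sets borel" and K[measurable]: "K \<in> N \<rightarrow>\<^sub>M config_algebra"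
  shows "(\<lambda>x. restr C (K x)) \<in> N \<rightarrow>\<^sub>M config_algebra"
proof -
  have "(\<lambda>x. restr (shift_set 0 C) (K x)) \<in> N \<rightarrow>\<^sub>M config_algebra"
    by (rule measurable_restr_moving[OF C borel_measurable_const K])
  moreover have "shift_set 0 C = C" by (auto simp: mem_shift_set)
  ultimately show ?thesis by simp
qed

section \<open>Counting measures are purely atomic\<close>

text \<open>
  The masses of the balls decrease to the mass of their centre, and a convergent sequence of natural numbers is
  eventually constant.
\<close>

lemma emeasure_ball_eq_singleton:
  assumes \<mu>: "\<mu> \<in> counting_measures"
  shows "\<exists>r>0. emeasure \<mu> (ball x r) = emeasure \<mu> {x}"
proof -
  note s = counting_measuresD[OF \<mu>]
  let ?B = "\<lambda>n. ball x (1 / Suc n)"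
  have fin: "emeasure \<mu> (?B n) < \<top>" for n
    by (intro emeasure_bounded_finite \<mu> bounded_ball)
  have nat_valued: "\<exists>i. emeasure \<mu> S = of_nat i" if S: "S \<in> sets borel" "emeasure \<mu> S < \<top>" for S
  proof -
    obtain e where e: "emeasure \<mu> S = ennreal_of_enat e" using s(3)[OF S(1)] by blast
    then show ?thesis using S(2) by (cases e) auto
  qed
  have dec: "decseq ?B"
    by (auto simp: decseq_def field_simps intro!: subset_ball frac_le)
  have "(\<Inter>n. ?B n) = {x}"
  proof (intro equalityI subsetI)
    fix y assume y: "y \<in> (\<Inter>n. ?B n)"
    have "dist x y = 0"
    proof (rule ccontr)
      assume "dist x y \<noteq> 0"
      then obtain n where "1 / Suc n < dist x y"
        using reals_Archimedean[of "dist x y"] by (auto simp: inverse_eq_divide)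
      then show False using y by (auto simp: not_less[symmetric] dest!: spec[of _ n])
    qed
    then show "y \<in> {x}" by simp
  qed auto
  moreover have "(\<lambda>n. emeasure \<mu> (?B n)) \<longlonglongrightarrow> emeasure \<mu> (\<Inter>n. ?B n)"
    using s(1) fin by (intro Lim_emeasure_decseq dec) (auto simp: less_top)
  ultimately have lim: "(\<lambda>n. emeasure \<mu> (?B n)) \<longlonglongrightarrow> emeasure \<mu> {x}" by simp
  obtain j where j: "emeasure \<mu> {x} = of_nat j"
    using nat_valued[of "{x}"] emeasure_bounded_finite[OF \<mu>, of "{x}"] by auto
  have "emeasure \<mu> {x} < of_nat (Suc j)" unfolding j of_nat_less_iff by simp
  from order_tendstoD(2)[OF lim this] obtain n where n: "emeasure \<mu> (?B n) < of_nat (Suc j)"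
    unfolding eventually_sequentially by blast
  obtain i where i: "emeasure \<mu> (?B n) = of_nat i"
    using nat_valued[of "?B n"] fin[of n] by auto
  have "emeasure \<mu> {x} \<le> emeasure \<mu> (?B n)"
    using s(1) by (intro emeasure_mono) auto
  then have "j \<le> i" unfolding i j of_nat_le_iff .
  moreover have "i < Suc j" using n unfolding i of_nat_less_iff .
  ultimately have "emeasure \<mu> (?B n) = emeasure \<mu> {x}" using i j by simp
  then show ?thesis by (intro exI[of _ "1 / Suc n"]) simp
qed

text \<open>
  By compactness finitely many balls in which only the centre carries mass cover \<open>K\<close>, so that the mass in \<open>K\<close>
  sits on finitely many centres.
\<close>

lemma points_in_compact:
  assumes \<mu>: "\<mu> \<in> counting_measures" and K: "compact K"
  shows "finite (points \<mu> \<inter> K)" "emeasure \<mu> (K - points \<mu>) = 0"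
proof -
  note s = counting_measuresD[OF \<mu>]
  obtain r where r: "\<And>x. r x > 0" "\<And>x. emeasure \<mu> (ball x (r x)) = emeasure \<mu> {x}"
    using emeasure_ball_eq_singleton[OF \<mu>] by metis
  have "K \<subseteq> (\<Union>x\<in>K. ball x (r x))" using r(1) by force
  then obtain F where F: "F \<subseteq> K" "finite F" "K \<subseteq> (\<Union>x\<in>F. ball x (r x))"
    using compactE_image[OF K, of K "\<lambda>x. ball x (r x)"] by auto
  have null: "ball x (r x) - {x} \<in> null_sets \<mu>" for x
  proof -
    have "emeasure \<mu> (ball x (r x) - {x}) = emeasure \<mu> (ball x (r x)) - emeasure \<mu> {x}"
      using s(1) r(1) emeasure_bounded_finite[OF \<mu>, of "{x}"] by (intro emeasure_Diff) auto
    then show ?thesis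
      using s(1) r(2) emeasure_bounded_finite[OF \<mu>, of "{x}"] by (simp add: null_sets_def)
  qed
  have "points \<mu> \<inter> K \<subseteq> F"
  proof
    fix y assume y: "y \<in> points \<mu> \<inter> K"
    then obtain x where x: "x \<in> F" "y \<in> ball x (r x)" using F(3) by auto
    have "y = x"
    proof (rule ccontr)
      assume "y \<noteq> x"
      then have "emeasure \<mu> {y} \<le> emeasure \<mu> (ball x (r x) - {x})"
        using s(1) x by (intro emeasure_mono) auto
      then show False using y null[of x] by (simp add: null_sets_def points_def)
    qed
    then show "y \<in> F" using x by simp
  qed
  then show fin: "finite (points \<mu> \<inter> K)" using F(2) finite_subset by blast
  have sub: "K - points \<mu> \<subseteq> (\<Union>x\<in>F. ball x (r x) - {x}) \<union> (\<Union>x\<in>F - points \<mu>. {x})"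
    using F(3) by blast
  have "(\<Union>x\<in>F. ball x (r x) - {x}) \<union> (\<Union>x\<in>F - points \<mu>. {x}) \<in> null_sets \<mu>"
    using F(2) null s(1) by (intro null_sets.Un null_sets_UN') (auto simp: null_sets_def points_def intro: countable_finite)
  moreover have "K - points \<mu> = K - (points \<mu> \<inter> K)" by blast
  then have "K - points \<mu> \<in> sets \<mu>"
    using fin K s(1) by (metis borel_compact finite_imp_closed borel_closed sets.Diff)
  ultimately show "emeasure \<mu> (K - points \<mu>) = 0"
    using null_sets_subset sub by (metis null_setsD1)
qed

lemma countable_points:
  assumes "\<mu> \<in> counting_measures"
  shows "countable (points \<mu>)"
proof -
  have "points \<mu> = (\<Union>n. points \<mu> \<inter> cball 0 (real n))"
    by (auto simp: real_arch_simple)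
  moreover have "countable (\<Union>n. points \<mu> \<inter> cball 0 (real n))"
    using points_in_compact(1)[OF assms] by (intro countable_UN) (auto intro: countable_finite)
  ultimately show ?thesis by simp
qed

lemma compl_points_null_set:
  assumes \<mu>: "\<mu> \<in> counting_measures"
  shows "- points \<mu> \<in> null_sets \<mu>"
proof -
  note s = counting_measuresD[OF \<mu>]
  have pts: "points \<mu> \<in> sets borel"
    using countable_points[OF \<mu>] by (rule sets.countable[rotated]) auto
  have "- points \<mu> = (\<Union>n. cball 0 (real n) - points \<mu>)"
    by (auto simp: real_arch_simple)
  moreover have "(\<Union>n. cball 0 (real n) - points \<mu>) \<in> null_sets \<mu>"
    using points_in_compact(2)[OF \<mu>] pts s(1) by (intro null_sets_UN) (auto simp: null_sets_def)
  ultimately show ?thesis by simp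
qed

definition simple_measure :: "'a measure \<Rightarrow> bool" where
  "simple_measure \<mu> \<longleftrightarrow> (\<forall>x. emeasure \<mu> {x} \<in> {0, 1})"

text \<open>
  All mass sits on the countably many atoms, and for a simple configuration each of them has mass one.
\<close>

lemma nn_integral_simple_measure:
  assumes \<mu>: "\<mu> \<in> counting_measures" and simple: "simple_measure \<mu>"
    and f[measurable]: "f \<in> borel_measurable borel"
  shows "(\<integral>\<^sup>+ x. f x \<partial>\<mu>) = (\<integral>\<^sup>+ x. f x \<partial>count_space (points \<mu>))"
proof -
  note s = counting_measuresD[OF \<mu>]
  have count: "countable (points \<mu>)" by (rule countable_points[OF \<mu>])
  have pts: "points \<mu> \<in> sets borel"
    using count by (rule sets.countable[rotated]) auto
  have "\<mu> = distr (count_space (points \<mu>)) borel (\<lambda>x. x)"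
  proof (rule measure_eqI)
    fix S assume "S \<in> sets \<mu>"
    then have S: "S \<in> sets borel" using s by simp
    let ?S = "S \<inter> points \<mu>"
    have cS: "countable ?S" using count by (rule countable_subset[rotated]) auto
    have "emeasure \<mu> S = emeasure \<mu> (S - - points \<mu>)"
      using compl_points_null_set[OF \<mu>] S s(1) by (intro emeasure_Diff_null_set[symmetric]) auto
    also have "S - - points \<mu> = ?S" by blast
    also have "emeasure \<mu> ?S = (\<integral>\<^sup>+x. emeasure \<mu> {x} \<partial>count_space ?S)"
      using s(1) cS by (intro emeasure_countable_singleton) auto
    also have "\<dots> = (\<integral>\<^sup>+x. emeasure (count_space (points \<mu>)) {x} \<partial>count_space ?S)"
      using simple by (intro nn_integral_cong) (auto simp: points_def simple_measure_def)
    also have "\<dots> = emeasure (count_space (points \<mu>)) ?S"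
      using cS by (intro emeasure_countable_singleton[symmetric]) auto
    also have "\<dots> = emeasure (distr (count_space (points \<mu>)) borel (\<lambda>x. x)) S"
      using S by (simp add: emeasure_distr)
    finally show "emeasure \<mu> S = emeasure (distr (count_space (points \<mu>)) borel (\<lambda>x. x)) S" .
  qed (simp add: s)
  then have "(\<integral>\<^sup>+ x. f x \<partial>\<mu>) = (\<integral>\<^sup>+ x. f x \<partial>distr (count_space (points \<mu>)) borel (\<lambda>x. x))"
    by simp
  also have "\<dots> = (\<integral>\<^sup>+ x. f x \<partial>count_space (points \<mu>))"
    by (rule nn_integral_distr) auto
  finally show ?thesis .
qed

section \<open>Sums over tuples of points\<close>

definition replace_coord :: "'a ^ 'k \<Rightarrow> 'k \<Rightarrow> 'a \<Rightarrow> 'a ^ 'k" where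
  "replace_coord x j y = (\<chi> i. if i = j then y else x $ i)"

text \<open>
  The coordinates outside \<open>J\<close> are frozen at those of \<open>x\<close> so that the sum over all tuples can be built up one
  coordinate at a time.
\<close>

definition partial_tuples :: "'k set \<Rightarrow> 'a measure \<Rightarrow> 'a ^ 'k \<Rightarrow> ('a ^ 'k) set" where
  "partial_tuples J \<mu> x = {w. \<forall>i. if i \<in> J then w $ i \<in> points \<mu> else w $ i = x $ i}"

lemma measurable_replace_coord [measurable (raw)]:
  fixes f :: "'b \<Rightarrow> 'a::euclidean_space ^ 'k"
  assumes "f \<in> borel_measurable N" "g \<in> borel_measurable N"
  shows "(\<lambda>x. replace_coord (f x) j (g x)) \<in> borel_measurable N"
proof (rule borel_measurable_continuous_Pair[OF assms])
  show "continuous_on UNIV (\<lambda>x. replace_coord (fst x) j (snd x :: 'a))"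
    unfolding replace_coord_def
  proof (rule continuous_on_vec_lambda)
    fix i show "continuous_on UNIV (\<lambda>x :: ('a ^ 'k) \<times> 'a. if i = j then snd x else fst x $ i)"
      by (cases "i = j") (auto intro!: continuous_intros)
  qed
qed

text \<open>
  Splits the tuples according to the value \<open>y\<close> of the coordinate \<open>j\<close>.
\<close>

lemma nn_integral_partial_tuples_insert:
  fixes F :: "'a ^ 'k \<Rightarrow> ennreal"
  assumes "countable (points \<mu>)" "j \<notin> J"
  shows "(\<integral>\<^sup>+ y. (\<integral>\<^sup>+ w. F w \<partial>count_space (partial_tuples J \<mu> (replace_coord x j y))) \<partial>count_space (points \<mu>))
    = (\<integral>\<^sup>+ w. F w \<partial>count_space (partial_tuples (insert j J) \<mu> x))"
proof -
  let ?T = "partial_tuples (insert j J) \<mu> x"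
  have mem: "w \<in> partial_tuples J \<mu> (replace_coord x j y) \<longleftrightarrow> w \<in> ?T \<and> w $ j = y" if "y \<in> points \<mu>" for w y
    using that assms(2) unfolding partial_tuples_def replace_coord_def by auto
  have "(\<integral>\<^sup>+ y. (\<integral>\<^sup>+ w. F w \<partial>count_space (partial_tuples J \<mu> (replace_coord x j y))) \<partial>count_space (points \<mu>))
    = (\<integral>\<^sup>+ y. (\<integral>\<^sup>+ w. F w * indicator ?T w * indicator {w $ j} y \<partial>count_space UNIV) \<partial>count_space (points \<mu>))"
    by (intro nn_integral_cong, subst nn_integral_count_space_indicator)
      (auto simp: mem split: split_indicator intro!: nn_integral_cong)
  also have "\<dots> = (\<integral>\<^sup>+ w. (\<integral>\<^sup>+ y. F w * indicator ?T w * indicator {w $ j} y \<partial>count_space (points \<mu>)) \<partial>count_space UNIV)"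
    by (rule nn_integral_count_space_nn_integral[symmetric, OF assms(1)]) simp
  also have "\<dots> = (\<integral>\<^sup>+ w. F w * indicator ?T w \<partial>count_space UNIV)"
  proof (intro nn_integral_cong)
    fix w
    show "(\<integral>\<^sup>+ y. F w * indicator ?T w * indicator {w $ j} y \<partial>count_space (points \<mu>)) = F w * indicator ?T w"
    proof (cases "w \<in> ?T")
      case True
      then have "w $ j \<in> points \<mu>" by (auto simp: partial_tuples_def)
      then show ?thesis by (subst nn_integral_cmult_indicator) auto
    qed simp
  qed
  also have "\<dots> = (\<integral>\<^sup>+ w. F w \<partial>count_space ?T)"
    by (subst (2) nn_integral_count_space_indicator) auto
  finally show ?thesis .
qed

text \<open>
  The function \<open>G\<close> is the iterated integral of \<open>F\<close> with respect to \<open>K s\<close> over the coordinates in \<open>J\<close>. This is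
  measurable for every configuration, but equals the sum over tuples only for simple ones: in general
  an iterated integral counts points with their multiplicity.
\<close>

lemma measurable_partial_tuple_sum:
  fixes F :: "('a::euclidean_space ^ 'k) \<times> 'b \<Rightarrow> ennreal"
  assumes K[measurable]: "K \<in> N \<rightarrow>\<^sub>M config_algebra"
    and F[measurable]: "F \<in> borel_measurable (borel \<Otimes>\<^sub>M N)" and "finite J"
  shows "\<exists>G \<in> borel_measurable (borel \<Otimes>\<^sub>M N). \<forall>s\<in>space N. simple_measure (K s) \<longrightarrow>
      (\<forall>x. G (x, s) = (\<integral>\<^sup>+ w. F (w, s) \<partial>count_space (partial_tuples J (K s) x)))"
  using \<open>finite J\<close>
proof induction
  case empty
  have "partial_tuples {} \<mu> x = {x}" for \<mu> :: "'a measure" and x :: "'a ^ 'k"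
    by (auto simp: partial_tuples_def vec_eq_iff)
  then show ?case using F by (intro bexI[of _ F]) (auto simp: nn_integral_count_space_finite)
next
  case (insert j J)
  then obtain G where G[measurable]: "G \<in> borel_measurable (borel \<Otimes>\<^sub>M N)"
    and eq: "\<And>s x. s \<in> space N \<Longrightarrow> simple_measure (K s) \<Longrightarrow>
      G (x, s) = (\<integral>\<^sup>+ w. F (w, s) \<partial>count_space (partial_tuples J (K s) x))"
    by blast
  let ?G = "\<lambda>xs. \<integral>\<^sup>+ y. G (replace_coord (fst xs) j y, snd xs) \<partial>K (snd xs)"
  have "?G \<in> borel_measurable (borel \<Otimes>\<^sub>M N)"
    by (rule measurable_nn_integral_config) (auto simp: split_beta')
  moreover have "?G (x, s) = (\<integral>\<^sup>+ w. F (w, s) \<partial>count_space (partial_tuples (insert j J) (K s) x))"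
    if s: "s \<in> space N" "simple_measure (K s)" for s x
  proof -
    have count: "K s \<in> counting_measures"
      using measurable_space[OF K s(1)] by (simp add: space_config_algebra)
    have [measurable]: "(\<lambda>y. G (replace_coord x j y, s)) \<in> borel_measurable borel"
      using s(1) by measurable
    have "?G (x, s) = (\<integral>\<^sup>+ y. G (replace_coord x j y, s) \<partial>count_space (points (K s)))"
      using nn_integral_simple_measure[OF count s(2), of "\<lambda>y. G (replace_coord x j y, s)"] by simp
    also have "\<dots> = (\<integral>\<^sup>+ w. F (w, s) \<partial>count_space (partial_tuples (insert j J) (K s) x))"
      unfolding eq[OF s] by (rule nn_integral_partial_tuples_insert[OF countable_points[OF count] insert(2)])
    finally show ?thesis .
  qed
  ultimately show ?case by (intro bexI[of _ ?G]) auto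
qed

text \<open>
  The tuples with distinct coordinates form an open set, so distinctness can be absorbed into the summand.
\<close>

lemma measurable_distinct_tuple_sum:
  fixes F :: "('a::euclidean_space ^ 'k) \<times> 'b \<Rightarrow> ennreal"
  assumes K[measurable]: "K \<in> N \<rightarrow>\<^sub>M config_algebra"
    and F[measurable]: "F \<in> borel_measurable (borel \<Otimes>\<^sub>M N)"
  obtains G where "G \<in> borel_measurable N"
    "\<And>s. s \<in> space N \<Longrightarrow> simple_measure (K s) \<Longrightarrow> G s = (\<integral>\<^sup>+ w. F (w, s) \<partial>count_space (distinct_tuples (K s)))"
proof -
  let ?I = "{w :: 'a ^ 'k. inj (($) w)}"
  have "?I = (\<Inter>i. \<Inter>j. if i = j then UNIV else {w. w $ i \<noteq> w $ j})"
    by (auto simp: inj_def split: if_splits)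
  moreover have "open (\<Inter>i::'k. \<Inter>j::'k. if i = j then UNIV else {w :: 'a ^ 'k. w $ i \<noteq> w $ j})"
    by (intro open_INT ballI) (auto intro!: open_Collect_neq continuous_intros)
  ultimately have [measurable]: "?I \<in> sets borel" by simp
  have "(\<lambda>ws. F ws * indicator ?I (fst ws)) \<in> borel_measurable (borel \<Otimes>\<^sub>M N)" by measurable
  from measurable_partial_tuple_sum[OF K this, of UNIV] obtain G
    where G: "G \<in> borel_measurable (borel \<Otimes>\<^sub>M N)"
      and eq: "\<And>s x. s \<in> space N \<Longrightarrow> simple_measure (K s) \<Longrightarrow>
        G (x, s) = (\<integral>\<^sup>+ w. F (w, s) * indicator ?I w \<partial>count_space (partial_tuples UNIV (K s) x))"
    by auto
  have "(\<lambda>s. G (0, s)) \<in> borel_measurable N" using G by measurable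
  moreover have "G (0, s) = (\<integral>\<^sup>+ w. F (w, s) \<partial>count_space (distinct_tuples (K s)))"
    if "s \<in> space N" "simple_measure (K s)" for s
  proof -
    have "(\<integral>\<^sup>+ w. F (w, s) * indicator ?I w \<partial>count_space (partial_tuples UNIV (K s) 0))
      = (\<integral>\<^sup>+ w. F (w, s) \<partial>count_space (distinct_tuples (K s)))"
      by (subst (1 2) nn_integral_count_space_indicator)
        (auto intro!: nn_integral_cong simp: distinct_tuples_def partial_tuples_def split: split_indicator)
    then show ?thesis using eq[OF that, of 0] by simp
  qed
  ultimately show thesis by (rule that)
qed

section \<open>The tuple process and its intensity\<close>

lemma nn_integral_tuple_process:
  assumes [measurable]: "\<phi> \<in> borel_measurable borel"
  shows "(\<integral>\<^sup>+ y. \<phi> y \<partial>tuple_process h z D \<mu>) =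
    (\<integral>\<^sup>+ x. ennreal (h x (restr (shift_set (z x) D) \<mu>)) * \<phi> (z x) \<partial>count_space (distinct_tuples \<mu>))"
  unfolding tuple_process_def
  by (subst nn_integral_distr) (simp_all add: nn_integral_density)

text \<open>
  The part of the tuple process in \<open>B\<close> is a function of the configuration in \<open>B + D\<close>: a tuple contributing a
  point \<open>z x \<in> B\<close> is decided within \<open>D + z x \<subseteq> B + D\<close> and, by the window condition, lies there. The left-hand
  side is this function.
\<close>

lemma tuple_process_from_window:
  fixes z :: "'a ^ 'k \<Rightarrow> 'a::euclidean_space"
  assumes \<mu>: "\<mu> \<in> counting_measures"
    and D: "D \<in> sets borel" and W: "B + D \<in> sets borel" and B[measurable]: "B \<in> sets borel"
    and h_range: "\<And>x \<mu>. \<mu> \<in> counting_measures \<Longrightarrow> h x \<mu> \<in> {0, 1 :: real}"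
    and window: "\<And>x. x \<in> distinct_tuples \<mu> \<Longrightarrow> h x (restr (shift_set (z x) D) \<mu>) = 1 \<Longrightarrow>
        \<forall>i. x $ i \<in> shift_set (z x) D"
    and \<phi>[measurable]: "\<phi> \<in> borel_measurable borel"
  shows "(\<integral>\<^sup>+ x. ennreal (h x (restr (shift_set (z x) D) (restr (B + D) \<mu>))) * (indicator B (z x) * \<phi> (z x))
      \<partial>count_space (distinct_tuples (restr (B + D) \<mu>)))
    = (\<integral>\<^sup>+ y. indicator B y * \<phi> y \<partial>tuple_process h z D \<mu>)"
proof -
  note s = counting_measuresD[OF \<mu>]
  let ?W = "B + D"
  have pts: "u \<in> points (restr ?W \<mu>) \<longleftrightarrow> u \<in> ?W \<and> u \<in> points \<mu>" for u
    using s(1) W by (cases "u \<in> ?W") (auto simp: points_def emeasure_restr)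
  have same: "h x (restr (shift_set (z x) D) (restr ?W \<mu>)) = h x (restr (shift_set (z x) D) \<mu>)"
    and sub: "shift_set (z x) D \<subseteq> ?W" if "z x \<in> B" for x
  proof -
    show "shift_set (z x) D \<subseteq> ?W"
      using that unfolding shift_set_def by (auto intro: set_plus_intro simp: add.commute[of _ "z x"])
    then show "h x (restr (shift_set (z x) D) (restr ?W \<mu>)) = h x (restr (shift_set (z x) D) \<mu>)"
      using s(1) W D by (simp add: restr_restr shift_set_borel)
  qed
  have h01: "h x (restr (shift_set (z x) D) \<mu>) \<in> {0, 1}" for x
    by (intro h_range restr_counting \<mu> shift_set_borel D)
  have "ennreal (h x (restr (shift_set (z x) D) (restr ?W \<mu>))) * (indicator B (z x) * \<phi> (z x)) *
      indicator (distinct_tuples (restr ?W \<mu>)) x =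
    ennreal (h x (restr (shift_set (z x) D) \<mu>)) * (indicator B (z x) * \<phi> (z x)) *
      indicator (distinct_tuples \<mu>) x" for x
  proof (cases "z x \<in> B")
    case True
    have "x \<in> distinct_tuples (restr ?W \<mu>) \<longleftrightarrow> x \<in> distinct_tuples \<mu>"
      if one: "h x (restr (shift_set (z x) D) \<mu>) = 1"
    proof
      assume "x \<in> distinct_tuples (restr ?W \<mu>)"
      then show "x \<in> distinct_tuples \<mu>" unfolding distinct_tuples_def pts by blast
    next
      assume x: "x \<in> distinct_tuples \<mu>"
      have "x $ i \<in> ?W" for i using window[OF x one] sub[OF True] by blast
      then show "x \<in> distinct_tuples (restr ?W \<mu>)"
        using x unfolding distinct_tuples_def pts by blast
    qed
    then show ?thesis
      using h01[of x] same[OF True] by (auto split: split_indicator)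
  qed simp
  then show ?thesis
    by (subst nn_integral_tuple_process, simp)
      (subst (1 2) nn_integral_count_space_indicator, simp_all)
qed

lemma sets_intensity: "sets (intensity M \<zeta>) = sets borel"
  unfolding intensity_def using sets.sigma_sets_eq[of borel] by simp

lemma emeasure_intensity:
  fixes \<zeta> :: "'w \<Rightarrow> 'a::euclidean_space measure"
  assumes \<zeta>[measurable]: "point_process M \<zeta>" and C: "C \<in> sets borel"
  shows "emeasure (intensity M \<zeta>) C = (\<integral>\<^sup>+ \<omega>. emeasure (\<zeta> \<omega>) C \<partial>M)"
proof (rule emeasure_measure_of[OF intensity_def])
  have sets_\<zeta>: "sets (\<zeta> \<omega>) = sets borel" if "\<omega> \<in> space M" for \<omega>
    using measurable_space[OF \<zeta> that] by (simp add: space_config_algebra counting_measuresD(1))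
  show "countably_additive (sets (intensity M \<zeta>)) (\<lambda>C. \<integral>\<^sup>+ \<omega>. emeasure (\<zeta> \<omega>) C \<partial>M)"
    unfolding sets_intensity
  proof (rule countably_additiveI)
    fix S :: "nat \<Rightarrow> 'a set" assume S: "range S \<subseteq> sets borel" "disjoint_family S"
    then have [measurable]: "S i \<in> sets borel" for i by auto
    have "(\<Sum>i. \<integral>\<^sup>+ \<omega>. emeasure (\<zeta> \<omega>) (S i) \<partial>M) = (\<integral>\<^sup>+ \<omega>. (\<Sum>i. emeasure (\<zeta> \<omega>) (S i)) \<partial>M)"
      by (rule nn_integral_suminf[symmetric]) measurable
    also have "\<dots> = (\<integral>\<^sup>+ \<omega>. emeasure (\<zeta> \<omega>) (\<Union>i. S i) \<partial>M)"
      using S sets_\<zeta> by (intro nn_integral_cong suminf_emeasure) auto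
    finally show "(\<Sum>i. \<integral>\<^sup>+ \<omega>. emeasure (\<zeta> \<omega>) (S i) \<partial>M) = (\<integral>\<^sup>+ \<omega>. emeasure (\<zeta> \<omega>) (\<Union>i. S i) \<partial>M)" .
  qed
qed (use C in \<open>auto simp: sets_intensity positive_def\<close>)

lemma sigma_finite_counting:
  assumes \<mu>: "\<mu> \<in> counting_measures"
  shows "sigma_finite_measure \<mu>"
proof
  note s = counting_measuresD[OF \<mu>]
  show "\<exists>A. countable A \<and> A \<subseteq> sets \<mu> \<and> \<Union> A = space \<mu> \<and> (\<forall>a\<in>A. emeasure \<mu> a \<noteq> \<infinity>)"
  proof (intro exI conjI)
    show "\<Union> (range (\<lambda>n. cball 0 (real n))) = space \<mu>"
      by (auto simp: s real_arch_simple)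
    show "\<forall>a\<in>range (\<lambda>n. cball 0 (real n)). emeasure \<mu> a \<noteq> \<infinity>"
      using s(4) by (auto simp: less_top)
  qed (auto simp: s)
qed

section \<open>Counting points by what is seen from them\<close>

text \<open>
  The Palm formula, applied to the indicator that \<open>x\<close> is in \<open>B\<close> and that \<open>\<mu>\<close>, seen from \<open>x\<close> through \<open>A\<close>, is
  in \<open>E\<close>. For the Palm version at \<open>x\<close>, a translate by \<open>x\<close>, the second condition does not depend on \<open>x\<close>.
\<close>

lemma palm_mark_integral:
  fixes \<xi> \<zeta> :: "'w \<Rightarrow> 'a::euclidean_space measure"
  assumes \<zeta>: "point_process M \<zeta>"
    and A: "A \<in> sets borel" and B[measurable]: "B \<in> sets borel"
    and E[measurable]: "E \<in> sets config_algebra"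
    and palm: "palm_version_origin M \<xi> \<zeta> M' \<xi>\<^sub>o"
  shows "(\<integral>\<^sup>+ \<omega>. (\<integral>\<^sup>+ y. indicator B y * indicator E (restr A (shift (- y) (\<xi> \<omega>))) \<partial>\<zeta> \<omega>) \<partial>M)
    = emeasure (distr M' config_algebra (\<lambda>\<omega>. restr A (\<xi>\<^sub>o \<omega>))) E * emeasure (intensity M \<zeta>) B"
proof -
  have \<xi>o[measurable]: "\<xi>\<^sub>o \<in> M' \<rightarrow>\<^sub>M config_algebra"
    and palm': "palm_version M \<xi> \<zeta> M' (\<lambda>x \<omega>'. shift x (\<xi>\<^sub>o \<omega>'))"
    using palm by (auto simp: palm_version_origin_def)
  define f :: "'a \<times> 'a measure \<Rightarrow> real"
    where "f u = indicator B (fst u) * indicator E (restr A (shift (- fst u) (snd u)))" for u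
  have [measurable]: "(\<lambda>u::'a \<times> 'a measure. restr A (shift (- fst u) (snd u))) \<in> borel \<Otimes>\<^sub>M config_algebra \<rightarrow>\<^sub>M config_algebra"
    by (intro measurable_restr A measurable_shift_moving) measurable
  have "(\<lambda>u. ennreal (f u)) \<in> borel_measurable (borel \<Otimes>\<^sub>M config_algebra)"
    unfolding f_def by measurable
  then have eq: "(\<integral>\<^sup>+ \<omega>. (\<integral>\<^sup>+ x. f (x, \<xi> \<omega>) \<partial>\<zeta> \<omega>) \<partial>M) =
      (\<integral>\<^sup>+ x. (\<integral>\<^sup>+ \<omega>'. f (x, shift x (\<xi>\<^sub>o \<omega>')) \<partial>M') \<partial>intensity M \<zeta>)"
    using palm' unfolding palm_version_def by simp
  let ?p = "emeasure (distr M' config_algebra (\<lambda>\<omega>. restr A (\<xi>\<^sub>o \<omega>))) E"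
  have [measurable]: "(\<lambda>\<omega>. restr A (\<xi>\<^sub>o \<omega>)) \<in> M' \<rightarrow>\<^sub>M config_algebra"
    by (intro measurable_restr A \<xi>o)
  have inner: "(\<integral>\<^sup>+ \<omega>'. f (x, shift x (\<xi>\<^sub>o \<omega>')) \<partial>M') = ?p * indicator B x" for x
  proof -
    have "(\<integral>\<^sup>+ \<omega>'. f (x, shift x (\<xi>\<^sub>o \<omega>')) \<partial>M') = (\<integral>\<^sup>+ \<omega>'. indicator B x * indicator E (restr A (\<xi>\<^sub>o \<omega>')) \<partial>M')"
    proof (intro nn_integral_cong)
      fix \<omega>' assume "\<omega>' \<in> space M'"
      then have "\<xi>\<^sub>o \<omega>' \<in> counting_measures"
        using measurable_space[OF \<xi>o] by (simp add: space_config_algebra)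
      then show "ennreal (f (x, shift x (\<xi>\<^sub>o \<omega>'))) = indicator B x * indicator E (restr A (\<xi>\<^sub>o \<omega>'))"
        by (simp add: f_def shift_minus_shift counting_measuresD(1) split: split_indicator)
    qed
    also have "\<dots> = indicator B x * (\<integral>\<^sup>+ \<omega>'. indicator E (restr A (\<xi>\<^sub>o \<omega>')) \<partial>M')"
      by (rule nn_integral_cmult) measurable
    also have "(\<integral>\<^sup>+ \<omega>'. indicator E (restr A (\<xi>\<^sub>o \<omega>')) \<partial>M') = (\<integral>\<^sup>+ \<nu>. indicator E \<nu> \<partial>distr M' config_algebra (\<lambda>\<omega>. restr A (\<xi>\<^sub>o \<omega>)))"
      by (subst nn_integral_distr) auto
    finally show ?thesis by (simp add: mult.commute)
  qed
  have "(\<integral>\<^sup>+ \<omega>. (\<integral>\<^sup>+ y. indicator B y * indicator E (restr A (shift (- y) (\<xi> \<omega>))) \<partial>\<zeta> \<omega>) \<partial>M)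
    = (\<integral>\<^sup>+ \<omega>. (\<integral>\<^sup>+ x. f (x, \<xi> \<omega>) \<partial>\<zeta> \<omega>) \<partial>M)"
    by (intro nn_integral_cong) (simp add: f_def split: split_indicator)
  also have "\<dots> = (\<integral>\<^sup>+ x. ?p * indicator B x \<partial>intensity M \<zeta>)"
    unfolding eq inner ..
  also have "\<dots> = ?p * emeasure (intensity M \<zeta>) B"
    by (rule nn_integral_cmult_indicator) (simp add: sets_intensity)
  finally show ?thesis .
qed

text \<open>
  When the points of \<open>\<nu>\<close> are independent of \<open>\<xi>\<close> (here: fixed), Fubini allows \<open>\<xi>\<close> to be integrated first, and by
  stationarity every \<open>y\<close> sees the event \<open>E\<close> with the same probability.
\<close>

lemma stationary_mark_integral:
  assumes M: "prob_space M" and \<xi>: "stationary_process M \<xi>" and \<nu>: "\<nu> \<in> counting_measures"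
    and A: "A \<in> sets borel" and B[measurable]: "B \<in> sets borel"
    and E[measurable]: "E \<in> sets config_algebra"
  shows "(\<integral>\<^sup>+ \<omega>. (\<integral>\<^sup>+ y. indicator B y * indicator E (restr A (shift (- y) (\<xi> \<omega>))) \<partial>\<nu>) \<partial>M)
    = emeasure (distr M config_algebra (\<lambda>\<omega>. restr A (\<xi> \<omega>))) E * emeasure \<nu> B"
proof -
  interpret M: prob_space M by fact
  interpret \<nu>: sigma_finite_measure \<nu> by (rule sigma_finite_counting[OF \<nu>])
  interpret pair_sigma_finite \<nu> M ..
  note s = counting_measuresD[OF \<nu>]
  note s(1)[measurable_cong]
  have \<xi>m[measurable]: "\<xi> \<in> M \<rightarrow>\<^sub>M config_algebra"
    and inv: "\<And>y. distr M config_algebra (\<lambda>\<omega>. shift y (\<xi> \<omega>)) = distr M config_algebra \<xi>"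
    using \<xi> by (auto simp: stationary_process_def)
  have restrA[measurable]: "restr A \<in> config_algebra \<rightarrow>\<^sub>M config_algebra"
    using measurable_restr[OF A measurable_id] by (simp add: id_def)
  have sh[measurable]: "(\<lambda>\<omega>. shift y (\<xi> \<omega>)) \<in> M \<rightarrow>\<^sub>M config_algebra" for y
    by (rule measurable_shift_moving) measurable
  have shift_meas[measurable]: "(\<lambda>u. shift (- fst u) (\<xi> (snd u))) \<in> \<nu> \<Otimes>\<^sub>M M \<rightarrow>\<^sub>M config_algebra"
    by (rule measurable_shift_moving) measurable
  let ?p = "emeasure (distr M config_algebra (\<lambda>\<omega>. restr A (\<xi> \<omega>))) E"
  have prob: "(\<integral>\<^sup>+ \<omega>. indicator E (restr A (shift (- y) (\<xi> \<omega>))) \<partial>M) = ?p" for y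
  proof -
    have "(\<integral>\<^sup>+ \<omega>. indicator E (restr A (shift (- y) (\<xi> \<omega>))) \<partial>M)
      = (\<integral>\<^sup>+ \<mu>. indicator E (restr A \<mu>) \<partial>distr M config_algebra (\<lambda>\<omega>. shift (- y) (\<xi> \<omega>)))"
      by (subst nn_integral_distr) auto
    also have "\<dots> = (\<integral>\<^sup>+ \<omega>. indicator E (restr A (\<xi> \<omega>)) \<partial>M)"
      unfolding inv by (subst nn_integral_distr) auto
    also have "\<dots> = (\<integral>\<^sup>+ \<mu>. indicator E \<mu> \<partial>distr M config_algebra (\<lambda>\<omega>. restr A (\<xi> \<omega>)))"
      by (subst nn_integral_distr) auto
    finally show ?thesis by simp
  qed
  have "(\<lambda>u. indicator B (fst u) * indicator E (restr A (shift (- fst u) (\<xi> (snd u)))) :: ennreal)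
      \<in> borel_measurable (\<nu> \<Otimes>\<^sub>M M)"
    by measurable
  then have "(\<integral>\<^sup>+ \<omega>. (\<integral>\<^sup>+ y. indicator B y * indicator E (restr A (shift (- y) (\<xi> \<omega>))) \<partial>\<nu>) \<partial>M)
    = (\<integral>\<^sup>+ y. (\<integral>\<^sup>+ \<omega>. indicator B y * indicator E (restr A (shift (- y) (\<xi> \<omega>))) \<partial>M) \<partial>\<nu>)"
    by (intro Fubini') (simp add: split_beta')
  also have "\<dots> = (\<integral>\<^sup>+ y. ?p * indicator B y \<partial>\<nu>)"
    using prob by (intro nn_integral_cong) (subst nn_integral_cmult, auto simp: mult.commute)
  also have "\<dots> = ?p * emeasure \<nu> B"
    by (rule nn_integral_cmult_indicator) (simp add: s)
  finally show ?thesis .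
qed

lemma measurable_from_config_algebra_on:
  "f \<in> N \<rightarrow>\<^sub>M config_algebra_on C \<Longrightarrow> f \<in> N \<rightarrow>\<^sub>M config_algebra"
  by (simp add: config_algebra_on_def measurable_restrict_space2_iff)

lemma measurable_restr_config_algebra_on:
  assumes C: "C \<in> sets borel" and \<xi>: "\<xi> \<in> M \<rightarrow>\<^sub>M config_algebra"
  shows "(\<lambda>\<omega>. restr C (\<xi> \<omega>)) \<in> M \<rightarrow>\<^sub>M config_algebra_on C"
  unfolding config_algebra_on_def
proof (rule measurable_restrict_space2[OF _ measurable_restr[OF C \<xi>]])
  show "(\<lambda>\<omega>. restr C (\<xi> \<omega>)) \<in> space M \<rightarrow> {\<mu>. emeasure \<mu> (- C) = 0}"
    using measurable_space[OF \<xi>] C by (auto simp: space_config_algebra emeasure_restr counting_measuresD(1))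
qed

lemma simple_measure_restr:
  assumes \<mu>: "\<mu> \<in> counting_measures" and C: "C \<in> sets borel" and simple: "simple_measure \<mu>"
  shows "simple_measure (restr C \<mu>)"
  unfolding simple_measure_def
proof
  fix x show "emeasure (restr C \<mu>) {x} \<in> {0, 1}"
    using simple counting_measuresD(1)[OF \<mu>] C
    by (cases "x \<in> C") (auto simp: simple_measure_def emeasure_restr)
qed

text \<open>
  A measurable function of the pair of restricted configurations that counts the points of the tuple process in
  \<open>B\<close> from which the second configuration is seen to be in \<open>E\<close>. It is characterised on simple
  configurations only, which suffices as the process is almost surely simple.
\<close>

lemma mark_functional:
  fixes h :: "'a::euclidean_space ^ 'k \<Rightarrow> 'a measure \<Rightarrow> real"
  assumes A: "A \<in> sets borel" and B[measurable]: "B \<in> sets borel" and D: "D \<in> sets borel"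
    and W: "B + D \<in> sets borel" and E[measurable]: "E \<in> sets config_algebra"
    and h[measurable]: "(\<lambda>(x, \<mu>). h x \<mu>) \<in> borel_measurable (borel \<Otimes>\<^sub>M config_algebra)"
    and h_range: "\<And>x \<mu>. \<mu> \<in> counting_measures \<Longrightarrow> h x \<mu> \<in> {0, 1}"
    and z[measurable]: "z \<in> borel_measurable borel"
  obtains G where
    "G \<in> borel_measurable (config_algebra_on (B + D) \<Otimes>\<^sub>M config_algebra_on V)"
    "\<And>\<mu> \<nu>. \<mu> \<in> counting_measures \<Longrightarrow> simple_measure \<mu> \<Longrightarrow> \<nu> \<in> space (config_algebra_on V) \<Longrightarrow>
      (\<And>x. x \<in> distinct_tuples \<mu> \<Longrightarrow> h x (restr (shift_set (z x) D) \<mu>) = 1 \<Longrightarrow>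
        \<forall>i. x $ i \<in> shift_set (z x) D) \<Longrightarrow>
      G (restr (B + D) \<mu>, \<nu>) =
        (\<integral>\<^sup>+ y. indicator B y * indicator E (restr A (shift (- y) \<nu>)) \<partial>tuple_process h z D \<mu>)"
proof -
  let ?N = "config_algebra_on (B + D) \<Otimes>\<^sub>M config_algebra_on V"
  \<comment> \<open>The contribution of a tuple \<open>fst u\<close> to the pair \<open>snd u\<close> of configurations.\<close>
  define F :: "('a ^ 'k) \<times> 'a measure \<times> 'a measure \<Rightarrow> ennreal"
    where "F u = ennreal (h (fst u) (restr (shift_set (z (fst u)) D) (fst (snd u)))) *
      (indicator B (z (fst u)) * indicator E (restr A (shift (- z (fst u)) (snd (snd u)))))" for u
  have fst_N[measurable]: "fst \<in> ?N \<rightarrow>\<^sub>M config_algebra" and snd_N[measurable]: "snd \<in> ?N \<rightarrow>\<^sub>M config_algebra"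
    by (rule measurable_from_config_algebra_on[OF measurable_fst] measurable_from_config_algebra_on[OF measurable_snd])+
  have z_fst[measurable]: "(\<lambda>u. z (fst u)) \<in> borel_measurable (borel \<Otimes>\<^sub>M ?N)"
    by measurable
  have "(\<lambda>u. restr (shift_set (z (fst u)) D) (fst (snd u))) \<in> borel \<Otimes>\<^sub>M ?N \<rightarrow>\<^sub>M config_algebra"
    by (intro measurable_restr_moving D z_fst measurable_compose[OF measurable_snd fst_N])
  then have "(\<lambda>u. (fst u, restr (shift_set (z (fst u)) D) (fst (snd u)))) \<in> borel \<Otimes>\<^sub>M ?N \<rightarrow>\<^sub>M borel \<Otimes>\<^sub>M config_algebra"
    by (intro measurable_Pair measurable_fst)
  from measurable_compose[OF this h]
  have [measurable]: "(\<lambda>u. h (fst u) (restr (shift_set (z (fst u)) D) (fst (snd u)))) \<in> borel_measurable (borel \<Otimes>\<^sub>M ?N)"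
    by simp
  have [measurable]: "(\<lambda>u. restr A (shift (- z (fst u)) (snd (snd u)))) \<in> borel \<Otimes>\<^sub>M ?N \<rightarrow>\<^sub>M config_algebra"
    by (intro measurable_restr A measurable_shift_moving borel_measurable_uminus z_fst measurable_compose[OF measurable_snd snd_N])
  have "F \<in> borel_measurable (borel \<Otimes>\<^sub>M ?N)"
    unfolding F_def by measurable
  from measurable_distinct_tuple_sum[OF fst_N this] obtain G
    where G: "G \<in> borel_measurable ?N"
      and eq: "\<And>s. s \<in> space ?N \<Longrightarrow> simple_measure (fst s) \<Longrightarrow>
        G s = (\<integral>\<^sup>+ w. F (w, s) \<partial>count_space (distinct_tuples (fst s)))"
    by blast
  have "G (restr (B + D) \<mu>, \<nu>) =
        (\<integral>\<^sup>+ y. indicator B y * indicator E (restr A (shift (- y) \<nu>)) \<partial>tuple_process h z D \<mu>)"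
    if \<mu>: "\<mu> \<in> counting_measures" "simple_measure \<mu>" and \<nu>: "\<nu> \<in> space (config_algebra_on V)"
      and window: "\<And>x. x \<in> distinct_tuples \<mu> \<Longrightarrow> h x (restr (shift_set (z x) D) \<mu>) = 1 \<Longrightarrow>
        \<forall>i. x $ i \<in> shift_set (z x) D" for \<mu> \<nu>
  proof -
    have "restr (B + D) \<mu> \<in> space (config_algebra_on (B + D))"
      using \<mu>(1) W counting_measuresD(1)[OF \<mu>(1)]
      by (simp add: config_algebra_on_def space_restrict_space space_config_algebra restr_counting emeasure_restr)
    then have "G (restr (B + D) \<mu>, \<nu>) = (\<integral>\<^sup>+ w. F (w, restr (B + D) \<mu>, \<nu>) \<partial>count_space (distinct_tuples (restr (B + D) \<mu>)))"
      using eq[of "(restr (B + D) \<mu>, \<nu>)"] \<nu> simple_measure_restr[OF \<mu>(1) W \<mu>(2)]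
      by (simp add: space_pair_measure)
    also have "\<dots> = (\<integral>\<^sup>+ y. indicator B y * indicator E (restr A (shift (- y) \<nu>)) \<partial>tuple_process h z D \<mu>)"
    proof -
      have \<nu>c: "\<nu> \<in> space config_algebra"
        using \<nu> by (simp add: config_algebra_on_def space_restrict_space)
      have [measurable]: "(\<lambda>y. restr A (shift (- y) \<nu>)) \<in> borel \<rightarrow>\<^sub>M config_algebra"
        by (intro measurable_restr A measurable_shift_moving borel_measurable_uminus measurable_ident measurable_const \<nu>c)
          (simp add: measurable_ident_sets)
      show ?thesis
        unfolding F_def fst_conv snd_conv
        by (rule tuple_process_from_window[OF \<mu>(1) D W B h_range window]) measurable
    qed
    finally show ?thesis .
  qed
  then show thesis using G that by blast
qed

text \<open>
  The exceptional set may depend on the first component only; this is what makes one almost sure identity usable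
  both under the joint law and under the product law, where \<open>Y\<close> is evaluated at an independent outcome.
\<close>

lemma nn_integral_joint_and_product:
  assumes M: "prob_space M" and X: "X \<in> M \<rightarrow>\<^sub>M S" and Y: "Y \<in> M \<rightarrow>\<^sub>M T"
    and k[measurable]: "k \<in> borel_measurable (S \<Otimes>\<^sub>M T)"
    and eq: "AE \<omega> in M. \<forall>\<nu>\<in>space T. k (X \<omega>, \<nu>) = v \<omega> \<nu>"
  shows nn_integral_joint: "(\<integral>\<^sup>+ s. k s \<partial>distr M (S \<Otimes>\<^sub>M T) (\<lambda>\<omega>. (X \<omega>, Y \<omega>))) = (\<integral>\<^sup>+ \<omega>. v \<omega> (Y \<omega>) \<partial>M)"
    and nn_integral_product: "(\<integral>\<^sup>+ s. k s \<partial>(distr M S X \<Otimes>\<^sub>M distr M T Y)) = (\<integral>\<^sup>+ \<omega>. (\<integral>\<^sup>+ \<omega>'. v \<omega> (Y \<omega>') \<partial>M) \<partial>M)"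
proof -
  interpret M: prob_space M by fact
  note X[measurable] Y[measurable]
  interpret Y: prob_space "distr M T Y" by (rule M.prob_space_distr[OF Y])
  have "(\<integral>\<^sup>+ s. k s \<partial>distr M (S \<Otimes>\<^sub>M T) (\<lambda>\<omega>. (X \<omega>, Y \<omega>))) = (\<integral>\<^sup>+ \<omega>. k (X \<omega>, Y \<omega>) \<partial>M)"
    by (rule nn_integral_distr) measurable
  also have "\<dots> = (\<integral>\<^sup>+ \<omega>. v \<omega> (Y \<omega>) \<partial>M)"
    by (rule nn_integral_cong_AE) (use eq measurable_space[OF Y] in auto)
  finally show "(\<integral>\<^sup>+ s. k s \<partial>distr M (S \<Otimes>\<^sub>M T) (\<lambda>\<omega>. (X \<omega>, Y \<omega>))) = (\<integral>\<^sup>+ \<omega>. v \<omega> (Y \<omega>) \<partial>M)" .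
  have "(\<integral>\<^sup>+ s. k s \<partial>(distr M S X \<Otimes>\<^sub>M distr M T Y)) = (\<integral>\<^sup>+ \<mu>. (\<integral>\<^sup>+ \<nu>. k (\<mu>, \<nu>) \<partial>distr M T Y) \<partial>distr M S X)"
    by (rule Y.nn_integral_fst[symmetric]) measurable
  also have "\<dots> = (\<integral>\<^sup>+ \<omega>. (\<integral>\<^sup>+ \<nu>. k (X \<omega>, \<nu>) \<partial>distr M T Y) \<partial>M)"
    by (rule nn_integral_distr) measurable
  also have "\<dots> = (\<integral>\<^sup>+ \<omega>. (\<integral>\<^sup>+ \<omega>'. k (X \<omega>, Y \<omega>') \<partial>M) \<partial>M)"
    by (intro nn_integral_cong nn_integral_distr) measurable
  also have "\<dots> = (\<integral>\<^sup>+ \<omega>. (\<integral>\<^sup>+ \<omega>'. v \<omega> (Y \<omega>') \<partial>M) \<partial>M)"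
    by (rule nn_integral_cong_AE) (use eq measurable_space[OF Y] in \<open>auto intro!: nn_integral_cong elim!: eventually_mono\<close>)
  finally show "(\<integral>\<^sup>+ s. k s \<partial>(distr M S X \<Otimes>\<^sub>M distr M T Y)) = (\<integral>\<^sup>+ \<omega>. (\<integral>\<^sup>+ \<omega>'. v \<omega> (Y \<omega>') \<partial>M) \<partial>M)" .
qed

section \<open>The total variation bound\<close>

theorem proposition2p2:
  fixes M :: "'w measure" and M' :: "'v measure"
    and \<xi> \<zeta> :: "'w \<Rightarrow> 'a::euclidean_space measure"
    and \<xi>\<^sub>o :: "'v \<Rightarrow> 'a measure"
    and A B D :: "'a set"
    and h :: "'a ^ 'k::finite \<Rightarrow> 'a measure \<Rightarrow> real"
    and z :: "'a ^ 'k \<Rightarrow> 'a"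
    and p q :: real
  assumes M: "prob_space M"
    and simple: "simple_process M \<xi>"
    and compact: "compact A" "compact B" "compact D"
    and restr_measurable:
      "(\<lambda>(x, \<mu>). (x, restr (shift_set x A) \<mu>)) \<in>
        borel \<Otimes>\<^sub>M config_algebra \<rightarrow>\<^sub>M borel \<Otimes>\<^sub>M config_algebra"
    and h_measurable: "(\<lambda>(x, \<mu>). h x \<mu>) \<in> borel_measurable (borel \<Otimes>\<^sub>M config_algebra)"
    and h_range: "\<And>x \<mu>. \<mu> \<in> counting_measures \<Longrightarrow> h x \<mu> \<in> {0, 1}"
    and h_invariant:
      "\<And>x \<mu> y. \<mu> \<in> counting_measures \<Longrightarrow> h (shift_tuple y x) (shift y \<mu>) = h x \<mu>"
    and z_measurable: "z \<in> borel_measurable borel"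
    and z_covariant: "\<And>x y. z (shift_tuple y x) = z x + y"
    and zeta: "AE \<omega> in M. \<zeta> \<omega> = tuple_process h z D (\<xi> \<omega>)"
    and window: "tuples_in_window M \<xi> h z D"
    and stationary: "stationary_process M \<xi>" "stationary_process M \<zeta>"
    and intensity: "0 < emeasure (intensity M \<zeta>) B" "emeasure (intensity M \<zeta>) B < \<infinity>"
    and palm: "palm_version_origin M \<xi> \<zeta> M' \<xi>\<^sub>o"
    and pq: "p > 0" "q > 0" "1 / p + 1 / q \<le> 1"
  shows "ennreal (d_TV M (\<lambda>\<omega>. restr A (\<xi> \<omega>)) M' (\<lambda>\<omega>. restr A (\<xi>\<^sub>o \<omega>)))
    \<le> 4 * (epowr (\<integral>\<^sup>+ \<omega>. epowr (emeasure (\<zeta> \<omega>) B) p \<partial>M) (1 / p) / emeasure (intensity M \<zeta>) B)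
        * epowr (ennreal (beta_mixing M \<xi> (B + D) (B + A))) (1 - 1 / p - 1 / q)"
proof -
  interpret M: prob_space M by (rule M)
  interpret M': prob_space M'
    using palm by (simp add: palm_version_origin_def palm_version_def)
  have \<xi>[measurable]: "\<xi> \<in> M \<rightarrow>\<^sub>M config_algebra" and \<zeta>[measurable]: "\<zeta> \<in> M \<rightarrow>\<^sub>M config_algebra"
    and \<xi>o[measurable]: "\<xi>\<^sub>o \<in> M' \<rightarrow>\<^sub>M config_algebra"
    using stationary palm by (auto simp: stationary_process_def palm_version_origin_def)
  have \<xi>c: "\<xi> \<omega> \<in> counting_measures" and \<zeta>c: "\<zeta> \<omega> \<in> counting_measures" if "\<omega> \<in> space M" for \<omega>
    using measurable_space[OF \<xi> that] measurable_space[OF \<zeta> that] by (simp_all add: space_config_algebra)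
  define W V where "W = B + D" and "V = B + A"
  have sum_eq: "S + S' = {x + y |x y. x \<in> S \<and> y \<in> S'}" for S S' :: "'a set"
    by (auto simp: set_plus_def)
  have A[measurable]: "A \<in> sets borel" and B[measurable]: "B \<in> sets borel" and D: "D \<in> sets borel"
    and W: "W \<in> sets borel" and V: "V \<in> sets borel"
    using compact compact_sums[OF compact(2) compact(3)] compact_sums[OF compact(2) compact(1)]
    by (auto simp: W_def V_def sum_eq borel_compact)
  define X Y where "X = (\<lambda>\<omega>. restr W (\<xi> \<omega>))" and "Y = (\<lambda>\<omega>. restr V (\<xi> \<omega>))"
  define S T where "S = config_algebra_on W" and "T = (config_algebra_on V :: 'a measure measure)"
  have X: "X \<in> M \<rightarrow>\<^sub>M S" and Y: "Y \<in> M \<rightarrow>\<^sub>M T"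
    unfolding X_def Y_def S_def T_def by (intro measurable_restr_config_algebra_on W V \<xi>)+
  define P Q where "P = distr M (S \<Otimes>\<^sub>M T) (\<lambda>\<omega>. (X \<omega>, Y \<omega>))" and "Q = distr M S X \<Otimes>\<^sub>M distr M T Y"
  have P: "prob_space P"
    unfolding P_def using X Y by (intro M.prob_space_distr) measurable
  have Q: "prob_space Q"
    unfolding Q_def by (intro prob_space_pair M.prob_space_distr X Y)
  have sets_P: "sets P = sets (S \<Otimes>\<^sub>M T)" and sets_Q: "sets Q = sets (S \<Otimes>\<^sub>M T)"
    unfolding P_def Q_def by (simp, intro sets_pair_measure_cong) simp_all
  define \<beta> where "\<beta> = beta_mixing M \<xi> W V"
  have \<beta>: "\<beta> = 1 / 2 * total_variation_mass P Q"
    unfolding \<beta>_def beta_mixing_def P_def Q_def S_def T_def X_def Y_def ..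
  have close: "\<bar>measure P E - measure Q E\<bar> \<le> \<beta>" if "E \<in> sets P" for E
    unfolding \<beta> by (rule setwise_diff_le_total_variation_mass[OF P Q _ that]) (simp add: sets_P sets_Q)
  have \<beta>1: "0 \<le> \<beta>" "\<beta> \<le> 1"
    using close[of "{}"] total_variation_mass_le_2[OF P Q] unfolding \<beta> by (auto simp: sets_P sets_Q)
  define \<gamma> where "\<gamma> = emeasure (intensity M \<zeta>) B"
  define m where "m = (\<integral>\<^sup>+ \<omega>. epowr (emeasure (\<zeta> \<omega>) B) p \<partial>M)"
  define R where "R = epowr m (1 / p) * epowr (ennreal \<beta>) (1 - 1 / p)"
  have p1: "1 < p"
  proof -
    have "0 < 1 / q" using pq(2) by simp
    then have "1 / p < 1" using pq(3) by linarith
    then show ?thesis using pq(1) by simp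
  qed

  define pE pE' where "pE = (\<lambda>E. measure (distr M config_algebra (\<lambda>\<omega>. restr A (\<xi> \<omega>))) E)"
    and "pE' = (\<lambda>E. measure (distr M' config_algebra (\<lambda>\<omega>. restr A (\<xi>\<^sub>o \<omega>))) E)"
  have bound: "ennreal \<bar>pE E - pE' E\<bar> * \<gamma> \<le> 2 * R" if E[measurable]: "E \<in> sets config_algebra" for E
  proof -
    \<comment> \<open>\<open>I E \<omega> \<nu>\<close> counts the points of \<open>\<zeta> \<omega>\<close> in \<open>B\<close> from which \<open>\<nu>\<close> is seen to be in \<open>E\<close>. With the certain event
      for \<open>E\<close> it is \<open>\<zeta>(B)\<close>, the dominating function.\<close>
    define I where "I E \<omega> \<nu> = (\<integral>\<^sup>+ y. indicator B y * indicator E (restr A (shift (- y) \<nu>)) \<partial>\<zeta> \<omega>)"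
      for E \<omega> and \<nu> :: "'a measure"
    have "\<exists>G\<in>borel_measurable (S \<Otimes>\<^sub>M T). AE \<omega> in M. \<forall>\<nu>\<in>space T. G (X \<omega>, \<nu>) = I E \<omega> \<nu>"
      if E: "E \<in> sets config_algebra" for E
    proof -
      obtain G where G: "G \<in> borel_measurable (S \<Otimes>\<^sub>M T)"
        and eq: "\<And>\<mu> \<nu>. \<mu> \<in> counting_measures \<Longrightarrow> simple_measure \<mu> \<Longrightarrow> \<nu> \<in> space T \<Longrightarrow>
          (\<And>x. x \<in> distinct_tuples \<mu> \<Longrightarrow> h x (restr (shift_set (z x) D) \<mu>) = 1 \<Longrightarrow>
            \<forall>i. x $ i \<in> shift_set (z x) D) \<Longrightarrow>
          G (restr W \<mu>, \<nu>) =
            (\<integral>\<^sup>+ y. indicator B y * indicator E (restr A (shift (- y) \<nu>)) \<partial>tuple_process h z D \<mu>)"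
        using mark_functional[OF A B D W[unfolded W_def] E h_measurable h_range z_measurable, of V]
        unfolding S_def T_def W_def by blast
      have "AE \<omega> in M. simple_measure (\<xi> \<omega>)"
        using simple by (simp add: simple_process_def simple_measure_def)
      then have "AE \<omega> in M. \<forall>\<nu>\<in>space T. G (X \<omega>, \<nu>) = I E \<omega> \<nu>"
        using zeta window[unfolded tuples_in_window_def] AE_space
      proof eventually_elim
        case (elim \<omega>)
        then show ?case unfolding X_def I_def using eq[of "\<xi> \<omega>"] \<xi>c by auto
      qed
      then show ?thesis using G by blast
    qed
    note this[OF E] this[OF sets.top]
    then obtain G Z where G[measurable]: "G \<in> borel_measurable (S \<Otimes>\<^sub>M T)" and Z[measurable]: "Z \<in> borel_measurable (S \<Otimes>\<^sub>M T)"
      and G_eq: "AE \<omega> in M. \<forall>\<nu>\<in>space T. G (X \<omega>, \<nu>) = I E \<omega> \<nu>"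
      and Z_eq0: "AE \<omega> in M. \<forall>\<nu>\<in>space T. Z (X \<omega>, \<nu>) = I (space config_algebra) \<omega> \<nu>"
      by blast
    have Z_eq: "AE \<omega> in M. \<forall>\<nu>\<in>space T. Z (X \<omega>, \<nu>) = emeasure (\<zeta> \<omega>) B"
      using Z_eq0 AE_space
    proof eventually_elim
      case (elim \<omega>)
      have "I (space config_algebra) \<omega> \<nu> = emeasure (\<zeta> \<omega>) B" if "\<nu> \<in> space T" for \<nu>
      proof -
        have "\<nu> \<in> counting_measures"
          using that by (simp add: T_def config_algebra_on_def space_restrict_space space_config_algebra)
        then have "I (space config_algebra) \<omega> \<nu> = (\<integral>\<^sup>+ y. indicator B y \<partial>\<zeta> \<omega>)"
          unfolding I_def by (simp add: space_config_algebra restr_counting shift_counting A)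
        then show ?thesis using counting_measuresD(1)[OF \<zeta>c[OF elim(2)]] by simp
      qed
      then show ?case using elim by simp
    qed
    \<comment> \<open>Taking the minimum enforces the domination by \<open>Z\<close> also where the configuration is not simple.\<close>
    define g where "g s = min (G s) (Z s)" for s
    have g[measurable]: "g \<in> borel_measurable (S \<Otimes>\<^sub>M T)" unfolding g_def by measurable
    have g_eq: "AE \<omega> in M. \<forall>\<nu>\<in>space T. g (X \<omega>, \<nu>) = I E \<omega> \<nu>"
      using G_eq Z_eq0
    proof eventually_elim
      case (elim \<omega>)
      have "I E \<omega> \<nu> \<le> I (space config_algebra) \<omega> \<nu>" for \<nu>
        unfolding I_def using sets.sets_into_space[OF E]
        by (intro nn_integral_mono) (auto split: split_indicator)
      then show ?case using elim by (simp add: g_def min_absorb1)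
    qed
    \<comment> \<open>From a point of \<open>B\<close>, the window \<open>A\<close> only shows what lies in \<open>V\<close>.\<close>
    have I_restr: "I E \<omega> (Y \<omega>') = I E \<omega> (\<xi> \<omega>')" if "\<omega>' \<in> space M" for \<omega> \<omega>'
      unfolding I_def
    proof (intro nn_integral_cong)
      fix y
      show "indicator B y * indicator E (restr A (shift (- y) (Y \<omega>'))) = (indicator B y * indicator E (restr A (shift (- y) (\<xi> \<omega>'))) :: ennreal)"
      proof (cases "y \<in> B")
        case True
        then have "restr A (shift (- y) (Y \<omega>')) = restr A (shift (- y) (\<xi> \<omega>'))"
          unfolding Y_def using counting_measuresD(1)[OF \<xi>c[OF that]]
          by (intro restr_shift_restr A V) (auto simp: V_def add.commute[of _ y] intro: set_plus_intro)
        then show ?thesis by simp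
      qed simp
    qed
    have "(\<integral>\<^sup>+ s. g s \<partial>P) = (\<integral>\<^sup>+ \<omega>. I E \<omega> (\<xi> \<omega>) \<partial>M)"
      unfolding P_def nn_integral_joint[OF M X Y g g_eq] by (intro nn_integral_cong I_restr)
    also have "\<dots> = emeasure (distr M' config_algebra (\<lambda>\<omega>. restr A (\<xi>\<^sub>o \<omega>))) E * \<gamma>"
      unfolding I_def \<gamma>_def by (rule palm_mark_integral[OF \<zeta> A B E palm])
    also have "emeasure (distr M' config_algebra (\<lambda>\<omega>. restr A (\<xi>\<^sub>o \<omega>))) E = ennreal (pE' E)"
    proof -
      interpret L: prob_space "distr M' config_algebra (\<lambda>\<omega>. restr A (\<xi>\<^sub>o \<omega>))"
        by (intro M'.prob_space_distr measurable_restr A \<xi>o)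
      show ?thesis by (simp add: pE'_def L.emeasure_eq_measure)
    qed
    finally have int_P: "(\<integral>\<^sup>+ s. g s \<partial>P) = ennreal (pE' E) * \<gamma>" .
    have "(\<integral>\<^sup>+ s. g s \<partial>Q) = (\<integral>\<^sup>+ \<omega>. (\<integral>\<^sup>+ \<omega>'. I E \<omega> (\<xi> \<omega>') \<partial>M) \<partial>M)"
      unfolding Q_def nn_integral_product[OF M X Y g g_eq] by (intro nn_integral_cong I_restr)
    also have "\<dots> = (\<integral>\<^sup>+ \<omega>. emeasure (distr M config_algebra (\<lambda>\<omega>. restr A (\<xi> \<omega>))) E * emeasure (\<zeta> \<omega>) B \<partial>M)"
      unfolding I_def by (intro nn_integral_cong stationary_mark_integral M stationary \<zeta>c A B E)
    also have "\<dots> = emeasure (distr M config_algebra (\<lambda>\<omega>. restr A (\<xi> \<omega>))) E * \<gamma>"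
      unfolding \<gamma>_def emeasure_intensity[OF \<zeta> B] by (rule nn_integral_cmult) measurable
    also have "emeasure (distr M config_algebra (\<lambda>\<omega>. restr A (\<xi> \<omega>))) E = ennreal (pE E)"
    proof -
      interpret L: prob_space "distr M config_algebra (\<lambda>\<omega>. restr A (\<xi> \<omega>))"
        by (intro M.prob_space_distr measurable_restr A \<xi>)
      show ?thesis by (simp add: pE_def L.emeasure_eq_measure)
    qed
    finally have int_Q: "(\<integral>\<^sup>+ s. g s \<partial>Q) = ennreal (pE E) * \<gamma>" .

    \<comment> \<open>The dominating function has the same moment under both laws, since it only depends on the first component.\<close>
    have Zp[measurable]: "(\<lambda>s. epowr (Z s) p) \<in> borel_measurable (S \<Otimes>\<^sub>M T)" by measurable
    have Zp_eq: "AE \<omega> in M. \<forall>\<nu>\<in>space T. epowr (Z (X \<omega>, \<nu>)) p = epowr (emeasure (\<zeta> \<omega>) B) p"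
      using Z_eq by eventually_elim simp
    have mP: "(\<integral>\<^sup>+ s. epowr (Z s) p \<partial>P) = m"
      unfolding P_def m_def by (rule nn_integral_joint[OF M X Y Zp Zp_eq])
    have mQ: "(\<integral>\<^sup>+ s. epowr (Z s) p \<partial>Q) = m"
      unfolding Q_def m_def nn_integral_product[OF M X Y Zp Zp_eq] by (simp add: M.emeasure_space_1)
    have mP': "f \<in> borel_measurable P" and mQ': "f \<in> borel_measurable Q"
      if "f \<in> borel_measurable (S \<Otimes>\<^sub>M T)" for f :: "_ \<Rightarrow> ennreal"
      using that by (simp_all cong: measurable_cong_sets add: sets_P sets_Q)
    have le: "g s \<le> Z s" for s by (simp add: g_def)
    have "ennreal (pE' E) * \<gamma> \<le> ennreal (pE E) * \<gamma> + 2 * R"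
      using nn_integral_le_of_setwise_close_moment[OF P Q _ close mP'[OF g] mP'[OF Z] le p1]
      unfolding int_P int_Q mP R_def by (simp add: sets_P sets_Q mult.assoc)
    moreover have "ennreal (pE E) * \<gamma> \<le> ennreal (pE' E) * \<gamma> + 2 * R"
      using nn_integral_le_of_setwise_close_moment[OF Q P _ _ mQ'[OF g] mQ'[OF Z] le p1, of \<beta>] close
      unfolding int_P int_Q mQ R_def by (simp add: sets_P sets_Q mult.assoc abs_minus_commute)
    moreover have "0 \<le> pE E" "0 \<le> pE' E" by (simp_all add: pE_def pE'_def)
    moreover obtain l where l: "\<gamma> = ennreal l" "0 \<le> l"
      using intensity(2) unfolding \<gamma>_def by (metis ennreal_cases infinity_ennreal_def less_irrefl)
    ultimately show ?thesis
    proof (cases "R = \<top>")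
      case False
      then obtain r where "R = ennreal r" "0 \<le> r" by (metis ennreal_cases)
      then have R: "2 * R = ennreal (2 * r)" "0 \<le> 2 * r" by (simp_all add: ennreal_mult)
      assume 1: "ennreal (pE' E) * \<gamma> \<le> ennreal (pE E) * \<gamma> + 2 * R"
        and 2: "ennreal (pE E) * \<gamma> \<le> ennreal (pE' E) * \<gamma> + 2 * R"
        and 3: "0 \<le> pE E" "0 \<le> pE' E"
      have "pE' E * l \<le> pE E * l + 2 * r"
        using 1 3 l(2) R(2) unfolding l R(1) by (simp flip: ennreal_mult ennreal_plus)
      moreover have "pE E * l \<le> pE' E * l + 2 * r"
        using 2 3 l(2) R(2) unfolding l R(1) by (simp flip: ennreal_mult ennreal_plus)
      ultimately have "\<bar>pE E - pE' E\<bar> * l \<le> 2 * r"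
        by (auto simp: abs_if algebra_simps)
      then show ?thesis unfolding l R(1) using l(2) by (simp flip: ennreal_mult add: ennreal_leI)
    qed (simp add: ennreal_mult_top)
  qed

  let ?s = "1 - 1 / p - 1 / q"
  define c where "c = 4 * (epowr m (1 / p) / \<gamma>) * epowr (ennreal \<beta>) ?s"
  have le_c: "ennreal \<bar>pE E - pE' E\<bar> \<le> c" if "E \<in> sets config_algebra" for E
  proof -
    have "epowr (ennreal \<beta>) (1 - 1 / p) \<le> epowr (ennreal \<beta>) ?s"
      using \<beta>1 pq by (intro epowr_antimono_exponent) auto
    then have "2 * R \<le> 4 * (epowr m (1 / p) * epowr (ennreal \<beta>) ?s)"
      unfolding R_def by (intro mult_mono) auto
    with bound[OF that] have "ennreal \<bar>pE E - pE' E\<bar> * \<gamma> \<le> 4 * (epowr m (1 / p) * epowr (ennreal \<beta>) ?s)"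
      by (rule order_trans)
    then have "ennreal \<bar>pE E - pE' E\<bar> * \<gamma> / \<gamma> \<le> 4 * (epowr m (1 / p) * epowr (ennreal \<beta>) ?s) / \<gamma>"
      by (rule divide_right_mono_ennreal)
    moreover have "ennreal \<bar>pE E - pE' E\<bar> * \<gamma> / \<gamma> = ennreal \<bar>pE E - pE' E\<bar>"
      using intensity unfolding \<gamma>_def by (intro ennreal_mult_divide_eq) auto
    ultimately show ?thesis
      unfolding c_def by (simp add: divide_ennreal_def ac_simps)
  qed
  have "ennreal (SUP E\<in>sets config_algebra. \<bar>pE E - pE' E\<bar>) \<le> c"
  proof (cases "c = \<top>")
    case False
    then obtain r where r: "c = ennreal r" "0 \<le> r" by (metis ennreal_cases)
    have "\<bar>pE E - pE' E\<bar> \<le> r" if "E \<in> sets config_algebra" for E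
      using le_c[OF that] r by simp
    then have "(SUP E\<in>sets config_algebra. \<bar>pE E - pE' E\<bar>) \<le> r"
      by (intro cSUP_least) auto
    then show ?thesis unfolding r(1) by (rule ennreal_leI)
  qed simp
  then show ?thesis
    unfolding c_def d_TV_def pE_def pE'_def m_def \<gamma>_def \<beta>_def W_def V_def .
qed

end
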